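(* Let $f:\mathbf{R}^n\to[0,\infty)$ be a log-concave function. Assume that $f\in L^1(\mathbf{R}^n)$, that $\mathrm{int}(P_f)\neq\emptyset$, and that $$\int_{\mathbf{R}^n}\Delta f(z)\,dz=2^n\int_{\mathbf{R}^n}f(x)\,dx .$$ Then there exist a non-singular $n\times n$ real matrix $A$, a number $C>0$ and a point $x_0\in\mathbf{R}^n$ such that, if $h$ is defined by $h(x)=Cf(Ax+x_0)$ for $x\in\mathbf{R}^n$, then: (i) $\mathrm{int}(P_h)=\{x=(x_1,\dots,x_n)\in\mathbf{R}^n : x_i>0,\ i=1,\dots,n\}$; (ii) $h(z)=h(z_1,\dots,z_n)=e^{-(z_1+\dots+z_n)}$ for every $z\in\mathrm{int}(P_h)$.
   Context: A function $f:\mathbf{R}^n\to[0,\infty)$ is log-concave if $f((1-t)x+ty)\ge f(x)^{1-t}f(y)^t$ for all $x,y\in\mathbf{R}^n$ and all $t\in[0,1]$. The difference function of a nonnegative function $f$ is $$\Delta f(z)=\sup\left\{\sqrt{f(x)f(-y)}\;:\;x,y\in\mathbf{R}^n,\ \tfrac12(x+y)=z\right\},\quad z\in\mathbf{R}^n.$$ For a nonnegative function $f$ on $\mathbf{R}^n$, $P_f=\{x\in\mathbf{R}^n : f(x)>0\}$, and $\mathrm{int}(P_f)$ denotes its interior. *)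

theory Defs
  imports "HOL-Analysis.Analysis"
begin

text \<open>Nonnegativity of \<open>f\<close> is not part of this definition. The convention \<open>0 powr 0 = 0\<close> is
  harmless: for nonnegative \<open>f\<close> the cases \<open>t = 0\<close> and \<open>t = 1\<close> hold whichever value is given to
  \<open>0 powr 0\<close>.\<close>

definition log_concave :: "('a::real_vector \<Rightarrow> real) \<Rightarrow> bool" where
  "log_concave f \<longleftrightarrow>
     (\<forall>x y. \<forall>t\<in>{0..1}. f ((1 - t) *\<^sub>R x + t *\<^sub>R y) \<ge> f x powr (1 - t) * f y powr t)"

text \<open>The supremum is taken in \<open>[0, \<infinity>]\<close>, so that it is meaningful for every nonnegative \<open>f\<close>.\<close>

definition difference_function :: "('a::real_vector \<Rightarrow> real) \<Rightarrow> 'a \<Rightarrow> ennreal" where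
  "difference_function f z =
     Sup {ennreal (sqrt (f x * f (- y))) | x y. (1 / 2) *\<^sub>R (x + y) = z}"

definition positivity_set :: "('a \<Rightarrow> real) \<Rightarrow> 'a set" where
  "positivity_set f = {x. f x > 0}"

end

theory Submission imports Defs begin

text \<open>Write \<open>C(z) = \<integral> f(y) f(y - z) dy\<close>. If \<open>x0 - x1 = 2 z\<close>, log-concavity gives
  \<open>f((x + x0)/2) f((x + x1)/2) \<ge> f(x) \<surd>(f(x0) f(x1))\<close>; integrating in \<open>x\<close> and taking the supremum
  yields \<open>2^n C(z) \<ge> \<Delta>f(z) \<integral> f\<close>, and integrating in \<open>z\<close> yields \<open>\<integral> \<Delta>f \<le> 2^n \<integral> f\<close>. In the equality
  case the pointwise inequalities are equalities for almost every \<open>z\<close>. A limit of maximizing pairs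
  \<open>(x0, x1)\<close> then satisfies \<open>f((x + xi)/2)\<^sup>2 = ai f(x)\<close> on \<open>P = int P\<^sub>f\<close>, and
  \<open>(2 P - x0) \<inter> (2 P - x1) = P\<close>; by compactness this persists for every \<open>z\<close> with \<open>2 z \<in> P - P\<close>.
  The case \<open>z = 0\<close> shows that \<open>P\<close> is a cone, with apex \<open>x0 = x1\<close> placed at the origin. The other
  \<open>z\<close> show that \<open>- ln f\<close> is additive on \<open>P\<close>, hence affine, and that the intersection of two
  translates of \<open>P\<close> is a translate of \<open>P\<close>. So \<open>P\<close> orders the space as a lattice, and the Riesz
  decomposition property makes the extreme rays of its closure linearly independent.\<close>

subsection \<open>Equality of integrals\<close>

text \<open>The two integrals coincide and are finite, so the nonnegative difference
  \<open>h - g\<close> integrates to zero.\<close>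

lemma AE_eq_of_nn_integral_le_measurable:
  fixes g h :: "'a \<Rightarrow> ennreal"
  assumes [measurable]: "g \<in> borel_measurable M" "h \<in> borel_measurable M"
    and le: "\<And>x. g x \<le> h x"
    and int: "integral\<^sup>N M h \<le> integral\<^sup>N M g" "integral\<^sup>N M g \<noteq> \<infinity>"
  shows "AE x in M. h x \<le> g x"
proof -
  have "(\<integral>\<^sup>+x. h x - g x \<partial>M) = integral\<^sup>N M h - integral\<^sup>N M g"
    by (rule nn_integral_diff) (use int le in auto)
  also have "\<dots> = 0"
    using int by (simp add: diff_eq_0_iff_ennreal top.not_eq_extremum)
  finally have "AE x in M. h x - g x = 0"
    by (subst (asm) nn_integral_0_iff_AE) auto
  then show ?thesis
    by (rule AE_mp) (auto simp: diff_eq_0_iff_ennreal intro!: AE_I2)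
qed

text \<open>No measurability of \<open>g\<close> is needed, because the integral of a nonmeasurable function is the
  supremum over the simple functions below it.\<close>
lemma AE_eq_of_nn_integral_le:
  fixes g h :: "'a \<Rightarrow> ennreal"
  assumes [measurable]: "h \<in> borel_measurable M"
    and le: "\<And>x. g x \<le> h x"
    and int: "integral\<^sup>N M h \<le> integral\<^sup>N M g" "integral\<^sup>N M g \<noteq> \<infinity>"
  shows "AE x in M. h x \<le> g x"
proof -
  let ?S = "{s. simple_function M s \<and> s \<le> g}"
  have "(\<lambda>_. 0) \<in> ?S" by (auto simp: le_fun_def)
  then have "integral\<^sup>S M ` ?S \<noteq> {}" by blast
  from ennreal_Sup_countable_SUP[OF this] obtain a :: "nat \<Rightarrow> ennreal"
    where a: "range a \<subseteq> integral\<^sup>S M ` ?S" "(SUP s\<in>?S. integral\<^sup>S M s) = (SUP i. a i)" by blast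
  then have "\<forall>i. \<exists>s\<in>?S. a i = integral\<^sup>S M s" by blast
  then obtain s where s: "\<And>i. simple_function M (s i)" "\<And>i. s i \<le> g" "\<And>i. a i = integral\<^sup>S M (s i)"
    by (metis (mono_tags, lifting) mem_Collect_eq)
  \<comment> \<open>A measurable minorant of \<open>g\<close> with the same integral; the measurable
    case applies to \<open>k\<close> and \<open>h\<close>.\<close>
  define k where "k x = (SUP i. s i x)" for x
  have [measurable]: "s i \<in> borel_measurable M" for i
    using s(1) by (rule borel_measurable_simple_function)
  have k[measurable]: "k \<in> borel_measurable M"
    unfolding k_def by measurable
  have kg: "k x \<le> g x" for x
    using s(2) by (auto simp: k_def le_fun_def intro!: SUP_least)
  have "integral\<^sup>N M g = (SUP i. a i)"
    using a(2) by (simp add: nn_integral_def)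
  also have "\<dots> \<le> integral\<^sup>N M k"
  proof (rule SUP_least)
    fix i
    have "a i = integral\<^sup>N M (s i)" by (simp add: s nn_integral_eq_simple_integral)
    also have "\<dots> \<le> integral\<^sup>N M k"
      by (rule nn_integral_mono) (auto simp: k_def intro!: SUP_upper)
    finally show "a i \<le> integral\<^sup>N M k" .
  qed
  finally have gk: "integral\<^sup>N M g \<le> integral\<^sup>N M k" .
  moreover have "integral\<^sup>N M k \<le> integral\<^sup>N M g"
    by (rule nn_integral_mono) (rule kg)
  ultimately have "AE x in M. h x \<le> k x"
    using int le kg by (intro AE_eq_of_nn_integral_le_measurable) (auto intro: order_trans)
  then show ?thesis
    by (rule AE_mp) (auto intro!: AE_I2 intro: order_trans kg)
qed

lemma nn_integral_lborel_affine:
  fixes t :: "'a::euclidean_space"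
  assumes [measurable]: "g \<in> borel_measurable borel" and c: "c \<noteq> 0"
  shows "(\<integral>\<^sup>+x. g x \<partial>lborel) = ennreal (\<bar>c\<bar> ^ DIM('a)) * (\<integral>\<^sup>+x. g (t + c *\<^sub>R x) \<partial>lborel)"
  by (subst lborel_affine[OF c, of t])
     (simp add: nn_integral_density nn_integral_distr nn_integral_cmult)

text \<open>Nonempty open sets are not negligible. This turns almost-everywhere statements into
  statements at points of a prescribed open set.\<close>

lemma AE_lborel_open_obtain:
  fixes U :: "'a::euclidean_space set"
  assumes "AE x in lborel. Pr x" "open U" "U \<noteq> {}"
  obtains x where "x \<in> U" "Pr x"
proof -
  have "\<exists>x\<in>U. Pr x"
  proof (rule ccontr)
    assume no: "\<not> ?thesis"
    obtain N where N: "N \<in> null_sets lborel" "{x. \<not> Pr x} \<subseteq> N"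
      using assms(1) by (auto simp: eventually_ae_filter)
    have "negligible N" using N(1) by (simp add: negligible_iff_null_sets null_sets_completionI)
    moreover have "U \<subseteq> N" using N(2) no by auto
    ultimately have "negligible U" using negligible_subset by blast
    then show False using assms open_not_negligible by blast
  qed
  then show ?thesis using that by blast
qed

subsection \<open>Lattice cones are simplicial\<close>

text \<open>In the order where \<open>x\<close> is below \<open>y\<close> iff \<open>y - x\<close>
  lies in \<open>K\<close>, the assumption \<open>K_sup\<close> provides a least upper bound of
  \<open>0\<close> and \<open>w\<close>. The strictly positive functional \<open>L\<close> cuts out
  a base of the cone.\<close>

locale lattice_cone =
  fixes K :: "'a::euclidean_space set" and L :: "'a \<Rightarrow> real"
  assumes K_add: "\<And>x y. x \<in> K \<Longrightarrow> y \<in> K \<Longrightarrow> x + y \<in> K"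
    and K_scale: "\<And>x t. x \<in> K \<Longrightarrow> 0 \<le> t \<Longrightarrow> t *\<^sub>R x \<in> K"
    and K_closed: "closed K"
    and K_span: "span K = UNIV"
    and L_linear: "linear L"
    and L_pos: "\<And>x. x \<in> K \<Longrightarrow> x \<noteq> 0 \<Longrightarrow> 0 < L x"
    and K_sup: "\<And>w. \<exists>c\<in>K. c - w \<in> K \<and> (\<forall>y\<in>K. y - w \<in> K \<longrightarrow> y - c \<in> K)"
begin

section \<open>Riesz decomposition and linear independence of the extreme rays\<close>

lemma L_nonneg: "x \<in> K \<Longrightarrow> 0 \<le> L x"
  using L_pos[of x] linear_0[OF L_linear] by (cases "x = 0") auto

text \<open>The element \<open>c\<close> is the positive part of \<open>x - y\<close>, so
  \<open>a = x - c\<close> is the infimum of \<open>x\<close> and \<open>y\<close>, and the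
  remainder \<open>b = c\<close> lies below \<open>z\<close> by minimality of
  \<open>c\<close>.\<close>

lemma riesz_decomposition:
  assumes "x \<in> K" "y \<in> K" "z \<in> K" "y + z - x \<in> K"
  obtains a b where "x = a + b" "a \<in> K" "b \<in> K" "y - a \<in> K" "z - b \<in> K"
proof -
  obtain c where c: "c \<in> K" "c - (x - y) \<in> K" "\<And>u. u \<in> K \<Longrightarrow> u - (x - y) \<in> K \<Longrightarrow> u - c \<in> K"
    using K_sup[of "x - y"] by blast
  have "z - c \<in> K" using c(3)[of z] assms by (simp add: algebra_simps)
  moreover have "x - c \<in> K" using c(3)[of x] assms by (simp add: algebra_simps)
  moreover have "y - (x - c) \<in> K" using c(2) by (simp add: algebra_simps)
  ultimately show ?thesis using that[of "x - c" c] c(1) by simp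
qed

definition base :: "'a set" where "base = {x \<in> K. L x = 1}"

definition extr :: "'a set" where "extr = {x. x extreme_point_of base}"

lemma normalize_base: "x \<in> K \<Longrightarrow> x \<noteq> 0 \<Longrightarrow> (1 / L x) *\<^sub>R x \<in> base"
  using L_pos[of x] by (auto simp: base_def linear_scale[OF L_linear] intro!: K_scale)

lemma extr_base: "e \<in> extr \<Longrightarrow> e \<in> base"
  by (simp add: extr_def extreme_point_of_def)

text \<open>Scaling \<open>x\<close> and \<open>l *\<^sub>R e - x\<close> into the base exhibits
  \<open>e\<close> as a proper convex combination of two base points; extremality makes them equal
  to \<open>e\<close>.\<close>

lemma extr_ray:
  assumes e: "e \<in> extr" and x: "x \<in> K" and y: "l *\<^sub>R e - x \<in> K"
  shows "x = L x *\<^sub>R e"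
proof -
  define z where "z = l *\<^sub>R e - x"
  have le: "L e = 1" using extr_base[OF e] by (simp add: base_def)
  have zK: "z \<in> K" and zL: "L z = l - L x"
    using y by (simp_all add: z_def linear_diff[OF L_linear] linear_scale[OF L_linear] le)
  consider "x = 0" | "z = 0" | "x \<noteq> 0" "z \<noteq> 0" by blast
  then show ?thesis
  proof cases
    case 1 then show ?thesis using linear_0[OF L_linear] by simp
  next
    case 2 then show ?thesis using zL linear_0[OF L_linear] by (simp add: z_def)
  next
    case 3
    define p q where "p = (1 / L x) *\<^sub>R x" and "q = (1 / L z) *\<^sub>R z"
    have pos: "0 < L x" "0 < L z" using 3 x zK L_pos by auto
    have pq: "p \<in> base" "q \<in> base" using 3 x zK by (auto simp: p_def q_def normalize_base)
    have l: "l = L x + L z" using zL by simp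
    have xp: "x = L x *\<^sub>R p" and zq: "z = L z *\<^sub>R q" using pos by (auto simp: p_def q_def)
    have "l *\<^sub>R e = L x *\<^sub>R p + L z *\<^sub>R q"
      using xp zq z_def by (metis add.commute diff_add_cancel)
    then have "(1 / l) *\<^sub>R l *\<^sub>R e = (1 / l) *\<^sub>R (L x *\<^sub>R p + L z *\<^sub>R q)" by simp
    then have ee: "e = (L x / l) *\<^sub>R p + (L z / l) *\<^sub>R q"
      using pos l by (simp add: scaleR_add_right)
    have "L x / l = 1 - L z / l" using pos l by (simp add: field_simps)
    then have ee: "e = (1 - L z / l) *\<^sub>R p + (L z / l) *\<^sub>R q" using ee by simp
    have "p = q"
    proof (rule ccontr)
      assume "p \<noteq> q"
      then have "e \<in> open_segment p q"
        unfolding in_segment using ee pos l by (auto intro!: exI[of _ "L z / l"])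
      then show False using e pq by (auto simp: extr_def extreme_point_of_def)
    qed
    then have "e = p" using ee by (simp add: algebra_simps)
    then show ?thesis using xp by simp
  qed
qed

lemma extr_not_dominated:
  assumes "finite J" "J \<subseteq> extr" "e \<in> extr" "e \<notin> J" "0 \<le> l" "\<And>j. j \<in> J \<Longrightarrow> 0 \<le> m j"
    and "(\<Sum>j\<in>J. m j *\<^sub>R j) - l *\<^sub>R e \<in> K"
  shows "l = 0"
  using assms
proof (induction J rule: finite_induct)
  case empty
  have "L e = 1" using extr_base[OF \<open>e \<in> extr\<close>] by (simp add: base_def)
  then have "L (- (l *\<^sub>R e)) = - l"
    by (simp add: linear_neg[OF L_linear] linear_scale[OF L_linear])
  then show ?case using empty L_nonneg[of "- (l *\<^sub>R e)"] by simp
next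
  case (insert j J)
  have K: "extr \<subseteq> K" using extr_base by (auto simp: base_def)
  have je: "j \<in> extr" "L j = 1" "L e = 1"
    using insert.prems extr_base by (auto simp: base_def)
  have "(\<Sum>i\<in>J. m i *\<^sub>R i) \<in> K"
    using \<open>finite J\<close> insert.prems(1) insert.prems(5)
  proof (induction J rule: finite_induct)
    case empty
    then show ?case using K_scale[of e 0] K \<open>e \<in> extr\<close> by auto
  next
    case (insert i J)
    have "m i *\<^sub>R i \<in> K" using insert.prems K by (intro K_scale) auto
    moreover have "(\<Sum>i\<in>J. m i *\<^sub>R i) \<in> K" using insert.prems by (intro insert.IH) auto
    ultimately show ?case using insert.hyps by (simp add: K_add)
  qed
  moreover have "l *\<^sub>R e \<in> K" "m j *\<^sub>R j \<in> K"
    using K_scale K insert.prems by auto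
  moreover have "m j *\<^sub>R j + (\<Sum>i\<in>J. m i *\<^sub>R i) - l *\<^sub>R e \<in> K"
    using insert.prems insert.hyps by simp
  ultimately obtain a b where ab: "l *\<^sub>R e = a + b" "a \<in> K" "b \<in> K" "m j *\<^sub>R j - a \<in> K"
      "(\<Sum>i\<in>J. m i *\<^sub>R i) - b \<in> K"
    using riesz_decomposition[of "l *\<^sub>R e" "m j *\<^sub>R j" "\<Sum>i\<in>J. m i *\<^sub>R i"] by blast
  have "a = L a *\<^sub>R j" using ab je by (intro extr_ray) auto
  moreover have "a = L a *\<^sub>R e" using ab insert.prems by (intro extr_ray[of e a l]) auto
  moreover have "j \<noteq> e" using insert.prems by auto
  ultimately have "L a = 0" by (metis scaleR_left_imp_eq)
  then have "a = 0" using ab(2) L_pos[of a] by force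
  then have "(\<Sum>i\<in>J. m i *\<^sub>R i) - l *\<^sub>R e \<in> K" using ab by simp
  then show ?case using insert.prems by (intro insert.IH) auto
qed

text \<open>In a linear relation, the terms with negative coefficients are moved to the other side;
  a single positive term is then dominated by a combination of other extreme points.\<close>

lemma independent_extr: "independent extr"
proof
  assume "dependent extr"
  then obtain S r v where S: "finite S" "S \<subseteq> extr" "(\<Sum>v\<in>S. r v *\<^sub>R v) = 0" "v \<in> S" "r v \<noteq> 0"
    unfolding dependent_explicit by blast
  \<comment> \<open>Replacing \<open>r\<close> by \<open>- r\<close> if necessary makes the
    distinguished coefficient positive.\<close>
  obtain r v where r: "(\<Sum>v\<in>S. r v *\<^sub>R v) = 0" "v \<in> S" "r v > 0"
  proof (cases "r v > 0")
    case True then show ?thesis using that S by blast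
  next
    case False then show ?thesis using that[of "\<lambda>x. - r x" v] S by (auto simp: sum_negf)
  qed
  define J where "J = {w \<in> S. r w < 0}"
  define I where "I = {w \<in> S. r w \<ge> 0} - {v}"
  have K: "extr \<subseteq> K" using extr_base by (auto simp: base_def)
  have "S = insert v (I \<union> J)" "v \<notin> I \<union> J" "I \<inter> J = {}" "finite I" "finite J"
    using r S(1) by (auto simp: I_def J_def)
  then have "r v *\<^sub>R v + ((\<Sum>w\<in>I. r w *\<^sub>R w) + (\<Sum>w\<in>J. r w *\<^sub>R w)) = 0"
    using r(1) by (simp add: sum.union_disjoint)
  then have "(\<Sum>w\<in>I. r w *\<^sub>R w) = (\<Sum>w\<in>J. (- r w) *\<^sub>R w) - r v *\<^sub>R v"
    by (simp add: sum_negf algebra_simps eq_neg_iff_add_eq_0)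
  moreover have "(\<Sum>w\<in>I. r w *\<^sub>R w) \<in> K"
  proof -
    have "0 \<in> K" using K_scale[of v 0] K S r by auto
    have "I \<subseteq> extr" "\<forall>w\<in>I. 0 \<le> r w" using S by (auto simp: I_def)
    with \<open>finite I\<close> show ?thesis
    proof (induction I rule: finite_induct)
      case (insert i I)
      then show ?case using K by (auto intro!: K_add K_scale)
    qed (simp add: \<open>0 \<in> K\<close>)
  qed
  ultimately have "r v = 0"
    using S r \<open>finite J\<close> by (intro extr_not_dominated[of J v "r v" "\<lambda>w. - r w"]) (auto simp: J_def)
  then show False using r by simp
qed

section \<open>Compactness of the base and generation of the cone by its extreme rays\<close>

lemma compact_base: "compact base"
proof -
  have cL: "continuous_on UNIV L" by (rule linear_continuous_on[OF L_linear[unfolded linear_conv_bounded_linear]])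
  have "base = K \<inter> {x. L x = 1}" by (auto simp: base_def)
  moreover have "closed {x. L x = 1}"
    using cL by (intro closed_Collect_eq) auto
  ultimately have "closed base" using K_closed by auto
  have "compact (K \<inter> sphere 0 1)" using K_closed by (simp add: closed_Int_compact)
  \<comment> \<open>By compactness \<open>L\<close> has a positive minimum on the unit vectors of
    \<open>K\<close>; by homogeneity its reciprocal bounds the norm on the base.\<close>
  have "bounded base"
  proof (cases "K \<inter> sphere 0 1 = {}")
    case True
    have "base = {}"
    proof (rule ccontr)
      assume "base \<noteq> {}"
      then obtain x where x: "x \<in> K" "L x = 1" by (auto simp: base_def)
      then have "x \<noteq> 0" using linear_0[OF L_linear] by auto
      then have "(1 / norm x) *\<^sub>R x \<in> K \<inter> sphere 0 1" using x K_scale by auto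
      then show False using True by auto
    qed
    then show ?thesis by simp
  next
    case False
    obtain z where z: "z \<in> K" "norm z = 1" and zmin: "\<And>y. y \<in> K \<Longrightarrow> norm y = 1 \<Longrightarrow> L z \<le> L y"
      using continuous_attains_inf[OF \<open>compact (K \<inter> sphere 0 1)\<close> False continuous_on_subset[OF cL]]
      by auto
    have "0 < L z" using z by (intro L_pos) auto
    have "norm x \<le> 1 / L z" if "x \<in> base" for x
    proof -
      have x: "x \<in> K" "L x = 1" using that by (auto simp: base_def)
      then have "x \<noteq> 0" using linear_0[OF L_linear] by auto
      then have "L z \<le> L ((1 / norm x) *\<^sub>R x)" using x K_scale by (intro zmin) auto
      also have "\<dots> = 1 / norm x" using x by (simp add: linear_scale[OF L_linear])
      finally show ?thesis using \<open>x \<noteq> 0\<close> \<open>0 < L z\<close> by (simp add: field_simps)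
    qed
    then show ?thesis by (auto simp: bounded_iff)
  qed
  then show ?thesis using \<open>closed base\<close> compact_eq_bounded_closed by blast
qed

lemma convex_base: "convex base"
proof (rule convexI)
  fix x y and u v :: real
  assume "x \<in> base" "y \<in> base" and uv: "0 \<le> u" "0 \<le> v" "u + v = 1"
  then have "x \<in> K" "y \<in> K" "L x = 1" "L y = 1" by (simp_all add: base_def)
  then show "u *\<^sub>R x + v *\<^sub>R y \<in> base"
    using uv by (simp add: base_def K_add K_scale linear_add[OF L_linear] linear_scale[OF L_linear])
qed

lemma finite_extr: "finite extr"
  using independent_bound[OF independent_extr] by simp

text \<open>Minkowski's theorem writes the normalized point as a convex combination of extreme
  points, which are finitely many because they are independent; multiplying by \<open>L x\<close>
  undoes the normalization.\<close>

lemma cone_eq_sums: "x \<in> K \<longleftrightarrow> (\<exists>u. (\<forall>e\<in>extr. 0 \<le> u e) \<and> x = (\<Sum>e\<in>extr. u e *\<^sub>R e))"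
proof
  assume x: "x \<in> K"
  show "\<exists>u. (\<forall>e\<in>extr. 0 \<le> u e) \<and> x = (\<Sum>e\<in>extr. u e *\<^sub>R e)"
  proof (cases "x = 0")
    case True then show ?thesis by (intro exI[of _ "\<lambda>_. 0"]) auto
  next
    case False
    have "(1 / L x) *\<^sub>R x \<in> convex hull extr"
      using normalize_base[OF x False] Krein_Milman_Minkowski[OF compact_base convex_base]
      by (simp add: extr_def)
    then obtain u where u: "\<forall>e\<in>extr. 0 \<le> u e" "(\<Sum>e\<in>extr. u e *\<^sub>R e) = (1 / L x) *\<^sub>R x"
      unfolding convex_hull_finite[OF finite_extr] by auto
    have "x = L x *\<^sub>R (\<Sum>e\<in>extr. u e *\<^sub>R e)" using u L_pos[OF x False] by simp
    also have "\<dots> = (\<Sum>e\<in>extr. (L x * u e) *\<^sub>R e)" by (simp add: scaleR_sum_right)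
    finally show ?thesis using u L_pos[OF x False] by (intro exI[of _ "\<lambda>e. L x * u e"]) auto
  qed
next
  have K: "extr \<subseteq> K" using extr_base by (auto simp: base_def)
  obtain c where "c \<in> K" using K_sup by blast
  then have "0 \<in> K" using K_scale[of c 0] by simp
  assume "\<exists>u. (\<forall>e\<in>extr. 0 \<le> u e) \<and> x = (\<Sum>e\<in>extr. u e *\<^sub>R e)"
  then obtain u where u: "\<forall>e\<in>extr. 0 \<le> u e" "x = (\<Sum>e\<in>extr. u e *\<^sub>R e)" by blast
  have "(\<Sum>e\<in>T. u e *\<^sub>R e) \<in> K" if "T \<subseteq> extr" for T
    using finite_subset[OF that finite_extr] that
  proof (induction T rule: finite_induct)
    case (insert i I)
    then show ?case using K u by (auto intro!: K_add K_scale)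
  qed (simp add: \<open>0 \<in> K\<close>)
  then show "x \<in> K" using u by blast
qed

lemma span_extr: "span extr = UNIV"
proof -
  have "K \<subseteq> span extr"
  proof
    fix x assume "x \<in> K"
    then obtain u where "x = (\<Sum>e\<in>extr. u e *\<^sub>R e)" using cone_eq_sums[of x] by metis
    then show "x \<in> span extr" by (simp add: span_sum span_scale span_base)
  qed
  then have "span K \<subseteq> span extr" by (simp add: span_minimal)
  then show ?thesis using K_span by auto
qed

lemma card_extr: "card extr = DIM('a)"
  using dim_span_eq_card_independent[OF independent_extr] by (simp add: span_extr)

end

subsection \<open>Cones cut by translates into translates\<close>

text \<open>\<open>Q\<close> stands for the translate of \<open>P\<close> with its apex at the
  origin and \<open>g\<close> for \<open>f\<close> shifted accordingly. The pair belonging to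
  \<open>z = 0\<close> accounts for \<open>double\<close> and \<open>g_half\<close>;
  \<open>touch\<close> provides such a pair for every difference of points of
  \<open>Q\<close>.\<close>

locale touching_cone =
  fixes Q :: "'a::euclidean_space set" and g :: "'a \<Rightarrow> real" and a :: real
  assumes Q: "open Q" "convex Q" "Q \<noteq> {}" "0 \<in> closure Q"
    and double: "\<And>x. x \<in> Q \<Longrightarrow> 2 *\<^sub>R x \<in> Q"
    and a_pos: "0 < a" and g_pos: "\<And>x. x \<in> Q \<Longrightarrow> 0 < g x"
    and g_half: "\<And>x. x \<in> Q \<Longrightarrow> (g ((1/2) *\<^sub>R x))\<^sup>2 = a * g x"
    and g_lc: "\<And>x y t. x \<in> Q \<Longrightarrow> y \<in> Q \<Longrightarrow> 0 < t \<Longrightarrow> t < 1 \<Longrightarrow>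
      g x powr (1 - t) * g y powr t \<le> g ((1 - t) *\<^sub>R x + t *\<^sub>R y)"
    and bounded_superlevel: "\<And>e. 0 < e \<Longrightarrow> bounded {x \<in> Q. e \<le> g x}"
    and touch: "\<And>p p'. p \<in> Q \<Longrightarrow> p' \<in> Q \<Longrightarrow> \<exists>x0 a0 x1 a1. x0 - x1 = p - p' \<and>
      x0 \<in> closure Q \<and> 0 < a0 \<and> (\<forall>x\<in>Q. (g ((1/2) *\<^sub>R (x + x0)))\<^sup>2 = a0 * g x) \<and>
      x1 \<in> closure Q \<and> 0 < a1 \<and> (\<forall>x\<in>Q. (g ((1/2) *\<^sub>R (x + x1)))\<^sup>2 = a1 * g x) \<and>
      (\<forall>x. (1/2) *\<^sub>R (x + x0) \<in> Q \<longrightarrow> (1/2) *\<^sub>R (x + x1) \<in> Q \<longrightarrow> x \<in> Q)"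
begin

section \<open>Cone properties of \<open>Q\<close>\<close>

lemma Q_scale:
  assumes x: "x \<in> Q" and t: "0 < t"
  shows "t *\<^sub>R x \<in> Q"
proof -
  obtain k where k: "t < 2 ^ k" using real_arch_pow[of 2 t] by auto
  have pow: "(2 ^ j) *\<^sub>R x \<in> Q" for j
  proof (induction j)
    case (Suc j) then show ?case using double[of "(2 ^ j) *\<^sub>R x"] by simp
  qed (simp add: x)
  \<comment> \<open>This point is \<open>t *\<^sub>R x\<close>. It lies strictly between
    \<open>0\<close>, a point of the closure, and the interior point
    \<open>(2 ^ k) *\<^sub>R x\<close>.\<close>
  have "0 - (t / 2 ^ k) *\<^sub>R (0 - (2 ^ k) *\<^sub>R x) \<in> interior Q"
    using Q pow k t by (intro mem_interior_closure_convex_shrink) (auto simp: interior_open)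
  then show ?thesis using interior_subset by auto
qed

text \<open>The midpoint of a point of \<open>Q\<close> and a point of its closure is interior;
  doubling it gives the sum.\<close>

lemma Q_add_closure:
  assumes x: "x \<in> Q" and y: "y \<in> closure Q"
  shows "x + y \<in> Q"
proof -
  have "y - (1/2) *\<^sub>R (y - x) \<in> interior Q"
    using Q x y by (intro mem_interior_closure_convex_shrink) (auto simp: interior_open)
  then have "2 *\<^sub>R (y - (1/2) *\<^sub>R (y - x)) \<in> Q" using interior_subset by (intro double) auto
  moreover have "2 *\<^sub>R (y - (1/2) *\<^sub>R (y - x)) = x + y" by (simp add: scaleR_diff_right scaleR_2)
  ultimately show ?thesis by simp
qed

lemma Q_add: "x \<in> Q \<Longrightarrow> y \<in> Q \<Longrightarrow> x + y \<in> Q"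
  using Q_add_closure closure_subset by blast

lemma in_closure_Q:
  assumes q: "q \<in> Q" and x: "\<And>t. 0 < t \<Longrightarrow> x + t *\<^sub>R q \<in> Q"
  shows "x \<in> closure Q"
proof (rule closed_sequentially[OF closed_closure])
  show "x + inverse (real (Suc k)) *\<^sub>R q \<in> closure Q" for k
    by (rule subsetD[OF closure_subset x]) simp
  have "(\<lambda>k. x + inverse (real (Suc k)) *\<^sub>R q) \<longlonglongrightarrow> x + 0 *\<^sub>R q"
    by (intro tendsto_intros LIMSEQ_inverse_real_of_nat)
  then show "(\<lambda>k. x + inverse (real (Suc k)) *\<^sub>R q) \<longlonglongrightarrow> x" by simp
qed

lemma half_in_Q_iff: "(1/2) *\<^sub>R x \<in> Q \<longleftrightarrow> x \<in> Q"
  using double[of "(1/2) *\<^sub>R x"] Q_scale[of x "1/2"] by auto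

text \<open>Since \<open>Q\<close> is open, \<open>q + t *\<^sub>R w\<close> stays in
  \<open>Q\<close> for small \<open>t\<close>; dividing by \<open>t\<close> stays in the
  cone.\<close>

lemma diff_of_Q: obtains p p' where "p \<in> Q" "p' \<in> Q" "w = p - p'"
proof -
  obtain q where q: "q \<in> Q" using Q by blast
  obtain e where e: "0 < e" "ball q e \<subseteq> Q" using Q(1) q by (metis open_contains_ball)
  \<comment> \<open>Small enough for \<open>norm (t *\<^sub>R w) < e\<close>; the summand
    \<open>1\<close> covers \<open>w = 0\<close>.\<close>
  define t where "t = e / (2 * (norm w + 1))"
  have nw: "0 < norm w + 1" using norm_ge_zero[of w] by linarith
  have t: "0 < t" using e nw by (simp add: t_def)
  have "t * norm w \<le> t * (norm w + 1)" using t by simp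
  also have "\<dots> = e / 2" using nw by (simp add: t_def field_simps)
  finally have "norm (t *\<^sub>R w) < e" using e t by simp
  then have "q + t *\<^sub>R w \<in> Q" using e(2) by (auto simp: dist_norm)
  then have "(1 / t) *\<^sub>R (q + t *\<^sub>R w) \<in> Q" "(1 / t) *\<^sub>R q \<in> Q"
    using Q_scale q t by auto
  moreover have "w = (1 / t) *\<^sub>R (q + t *\<^sub>R w) - (1 / t) *\<^sub>R q"
    using t by (simp add: scaleR_add_right)
  ultimately show ?thesis by (rule that)
qed

text \<open>The cone structure removes the halves from \<open>touch\<close>: by
  \<open>g_half\<close> the squared midpoint value is \<open>a * g (x + x0)\<close>, and membership
  in \<open>Q\<close> is invariant under halving. Contact becomes a statement about
  translations.\<close>

lemma touch_cone:
  obtains x0 a0 x1 a1 where "x0 - x1 = w"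
    "x0 \<in> closure Q" "0 < a0" "\<And>x. x \<in> Q \<Longrightarrow> a * g (x + x0) = a0 * g x"
    "x1 \<in> closure Q" "0 < a1" "\<And>x. x \<in> Q \<Longrightarrow> a * g (x + x1) = a1 * g x"
    "\<And>x. x + x0 \<in> Q \<Longrightarrow> x + x1 \<in> Q \<Longrightarrow> x \<in> Q"
proof -
  obtain p p' where p: "p \<in> Q" "p' \<in> Q" "w = p - p'" by (rule diff_of_Q)
  obtain x0 a0 x1 a1 where x: "x0 - x1 = p - p'"
    "x0 \<in> closure Q" "0 < a0" "\<forall>x\<in>Q. (g ((1/2) *\<^sub>R (x + x0)))\<^sup>2 = a0 * g x"
    "x1 \<in> closure Q" "0 < a1" "\<forall>x\<in>Q. (g ((1/2) *\<^sub>R (x + x1)))\<^sup>2 = a1 * g x"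
    "\<forall>x. (1/2) *\<^sub>R (x + x0) \<in> Q \<longrightarrow> (1/2) *\<^sub>R (x + x1) \<in> Q \<longrightarrow> x \<in> Q"
    using touch[OF p(1,2)] by metis
  show ?thesis
  proof (rule that[of x0 x1 a0 a1])
    show "a * g (y + x0) = a0 * g y" if "y \<in> Q" for y
      using x(4) g_half[of "y + x0"] Q_add_closure[OF that x(2)] that by metis
    show "a * g (y + x1) = a1 * g y" if "y \<in> Q" for y
      using x(7) g_half[of "y + x1"] Q_add_closure[OF that x(5)] that by metis
    show "y \<in> Q" if "y + x0 \<in> Q" "y + x1 \<in> Q" for y
      using x(8) that half_in_Q_iff by metis
  qed (use x p in auto)
qed

text \<open>An arithmetic progression inside a bounded superlevel set must be constant.\<close>

lemma superlevel_ray: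
  assumes "x \<in> Q" "\<And>k::nat. x + real k *\<^sub>R y \<in> Q \<and> g x \<le> g (x + real k *\<^sub>R y)"
  shows "y = 0"
proof (rule ccontr)
  assume y: "y \<noteq> 0"
  have "bounded {z \<in> Q. g x \<le> g z}" using g_pos assms by (intro bounded_superlevel) auto
  then obtain R where R: "\<And>z. z \<in> Q \<Longrightarrow> g x \<le> g z \<Longrightarrow> norm z \<le> R" by (auto simp: bounded_iff)
  obtain k :: nat where k: "(R + norm x) / norm y < real k" using reals_Archimedean2 by blast
  have "norm (real k *\<^sub>R y) \<le> norm (x + real k *\<^sub>R y) + norm x"
    using norm_triangle_ineq4[of "x + real k *\<^sub>R y" x] by simp
  also have "\<dots> \<le> R + norm x" using R assms(2)[of k] by simp
  finally show False using k y by (simp add: field_simps)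
qed

text \<open>For \<open>w \<in> Q\<close> the contact points can only be \<open>x0 = w\<close> and \<open>x1 = 0\<close>: translation by \<open>x1\<close> maps \<open>Q\<close>
  onto itself and multiplies \<open>g\<close> by a constant, so that otherwise a superlevel set would contain an
  unbounded sequence.\<close>
lemma multiplicative:
  assumes w: "w \<in> Q"
  obtains b where "\<And>x. x \<in> Q \<Longrightarrow> a * g (x + w) = b * g x"
proof -
  obtain x0 a0 x1 a1 where x: "x0 - x1 = w"
    "x0 \<in> closure Q" "0 < a0" "\<And>x. x \<in> Q \<Longrightarrow> a * g (x + x0) = a0 * g x"
    "x1 \<in> closure Q" "0 < a1" "\<And>x. x \<in> Q \<Longrightarrow> a * g (x + x1) = a1 * g x"
    "\<And>x. x + x0 \<in> Q \<Longrightarrow> x + x1 \<in> Q \<Longrightarrow> x \<in> Q"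
    by (rule touch_cone[of w]) (rule that)
  \<comment> \<open>Adding \<open>x0\<close> to \<open>y - x1\<close> gives \<open>y + w\<close> and
    adding \<open>x1\<close> gives \<open>y\<close>. Both lie in \<open>Q\<close>, so the contact
    inclusion applies; this is where \<open>w\<close> in \<open>Q\<close> enters.\<close>
  have sub: "y - x1 \<in> Q" if "y \<in> Q" for y
  proof (rule x(8))
    have "y - x1 + x0 = y + w" using x(1) by (simp add: algebra_simps)
    then show "y - x1 + x0 \<in> Q" using Q_add[OF that w] by metis
  qed (simp add: that)
  have iter: "y + real k *\<^sub>R z \<in> Q \<and> g y \<le> g (y + real k *\<^sub>R z)"
    if y: "y \<in> Q" and step: "\<And>u. u \<in> Q \<Longrightarrow> u + z \<in> Q \<and> g u \<le> g (u + z)" for y z and k :: nat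
  proof (induction k)
    case (Suc k)
    have "y + real (Suc k) *\<^sub>R z = (y + real k *\<^sub>R z) + z" by (simp add: algebra_simps)
    then show ?case using step[of "y + real k *\<^sub>R z"] Suc by (metis order.trans)
  qed (simp add: y)
  obtain q where q: "q \<in> Q" using Q by blast
  have "x1 = 0"
  \<comment> \<open>Translation by \<open>x1\<close> multiplies \<open>g\<close> by
    \<open>a1 / a\<close>. Iterating it, or its inverse if this factor is below 1, never decreases
    \<open>g\<close>.\<close>
  proof (cases "a \<le> a1")
    case True
    have "u + x1 \<in> Q \<and> g u \<le> g (u + x1)" if "u \<in> Q" for u
    proof -
      have "a * g u \<le> a1 * g u" using True g_pos[OF that] by (intro mult_right_mono) auto
      then have "a * g u \<le> a * g (u + x1)" using x(7)[OF that] by simp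
      then show ?thesis using Q_add_closure[OF that x(5)] a_pos by simp
    qed
    then show ?thesis using superlevel_ray[OF q iter[OF q]] by blast
  next
    case False
    have "u + (- x1) \<in> Q \<and> g u \<le> g (u + (- x1))" if "u \<in> Q" for u
    proof -
      have "a * g u = a1 * g (u - x1)" using x(7)[OF sub[OF that]] by simp
      also have "\<dots> \<le> a * g (u - x1)" using False g_pos[OF sub[OF that]] by (intro mult_right_mono) auto
      finally show ?thesis using sub[OF that] a_pos by simp
    qed
    then have "- x1 = 0" using superlevel_ray[OF q iter[OF q]] by blast
    then show ?thesis by simp
  qed
  then have "x0 = w" using x(1) by simp
  show ?thesis by (rule that[of a0]) (use x(4) \<open>x0 = w\<close> in auto)
qed

section \<open>Additivity and linearity of the negative logarithm of \<open>g\<close>\<close>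

definition u :: "'a \<Rightarrow> real" where "u x = ln a - ln (g x)"

lemma g_eq: "x \<in> Q \<Longrightarrow> g x = a * exp (- u x)"
  using g_pos a_pos by (simp add: u_def exp_diff exp_minus field_simps)

text \<open>Evaluating the multiplicative relation at \<open>x = w\<close> and comparing with
  \<open>g_half\<close> at \<open>w + w\<close> identifies the factor \<open>b\<close> as
  \<open>g w\<close>. The term \<open>ln a\<close> in \<open>u\<close> absorbs the remaining
  constant, so that \<open>u\<close> is additive and not merely affine.\<close>

lemma u_add:
  assumes x: "x \<in> Q" and w: "w \<in> Q"
  shows "u (x + w) = u x + u w"
proof -
  obtain b where b: "\<And>x. x \<in> Q \<Longrightarrow> a * g (x + w) = b * g x" by (rule multiplicative[OF w]) (rule that)
  have "(1/2) *\<^sub>R (w + w) = w" by (simp add: scaleR_2[symmetric])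
  then have "(g w)\<^sup>2 = b * g w" using g_half[OF Q_add[OF w w]] b[OF w] by simp
  then have "b = g w" using g_pos[OF w] by (simp add: power2_eq_square)
  then have "ln (a * g (x + w)) = ln (g w * g x)" using b[OF x] by simp
  then show ?thesis
    using a_pos g_pos[OF x] g_pos[OF w] g_pos[OF Q_add[OF x w]] by (simp add: u_def ln_mult)
qed

lemma u_convex:
  assumes "x \<in> Q" "y \<in> Q" "0 < t" "t < 1"
  shows "u ((1 - t) *\<^sub>R x + t *\<^sub>R y) \<le> (1 - t) * u x + t * u y"
proof -
  have "(1 - t) * ln (g x) + t * ln (g y) = ln (g x powr (1 - t) * g y powr t)"
    using g_pos[OF assms(1)] g_pos[OF assms(2)] by (simp add: ln_mult ln_powr)
  also have "\<dots> \<le> ln (g ((1 - t) *\<^sub>R x + t *\<^sub>R y))"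
    using g_pos[OF assms(1)] g_pos[OF assms(2)] g_lc[OF assms] by (intro ln_mono) auto
  finally show ?thesis by (simp add: u_def algebra_simps)
qed

text \<open>By convexity and additivity, the defect \<open>u (t x) - t u x\<close> is at most the defect at any other
  point; being additive in \<open>x\<close>, it vanishes.\<close>

lemma u_scale_less_1:
  assumes x: "x \<in> Q" and t: "0 < t" "t < 1"
  shows "u (t *\<^sub>R x) = t * u x"
proof -
  define D where "D s y = u (s *\<^sub>R y) - s * u y" for s y
  have le: "D (1 - t) y + D t z \<le> 0" if "y \<in> Q" "z \<in> Q" for y z
    using u_convex[OF that t] u_add[of "(1 - t) *\<^sub>R y" "t *\<^sub>R z"] Q_scale that t by (simp add: D_def)
  have eq: "D (1 - t) y + D t y = 0" if "y \<in> Q" for y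
  proof -
    have "(1 - t) *\<^sub>R y + t *\<^sub>R y = y" by (simp add: scaleR_add_left[symmetric])
    then have "u ((1 - t) *\<^sub>R y) + u (t *\<^sub>R y) = u y"
      using u_add[of "(1 - t) *\<^sub>R y" "t *\<^sub>R y"] Q_scale that t by simp
    then show ?thesis by (simp add: D_def algebra_simps)
  qed
  have D_le: "D t z \<le> D t y" if "y \<in> Q" "z \<in> Q" for y z
    using le[OF that] eq[OF that(1)] by linarith
  have "D t (x + x) = 2 * D t x"
    using u_add[OF x x] u_add[of "t *\<^sub>R x" "t *\<^sub>R x"] Q_scale[OF x t(1)]
    by (simp add: D_def scaleR_add_right algebra_simps)
  moreover have "D t (x + x) = D t x"
    using D_le[OF x Q_add[OF x x]] D_le[OF Q_add[OF x x] x] by simp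
  ultimately show ?thesis by (simp add: D_def)
qed

lemma u_scale:
  assumes x: "x \<in> Q" and t: "0 < t"
  shows "u (t *\<^sub>R x) = t * u x"
proof (cases "t < 1")
  case False
  show ?thesis
  proof (cases "t = 1")
    case False
    \<comment> \<open>For \<open>t > 1\<close> the previous case is used at the point
      \<open>t *\<^sub>R x\<close> with factor \<open>1 / t\<close>.\<close>
    then have "u ((1 / t) *\<^sub>R (t *\<^sub>R x)) = (1 / t) * u (t *\<^sub>R x)"
      using \<open>\<not> t < 1\<close> t Q_scale[OF x t] by (intro u_scale_less_1) auto
    then show ?thesis using t by (simp add: field_simps)
  qed simp
qed (use u_scale_less_1 assms in auto)

text \<open>The extension of \<open>u\<close> to the whole space, every vector being a difference of
  points of \<open>Q\<close>. The choice of \<open>p\<close> is immaterial by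
  \<open>L_diff\<close>.\<close>

definition L :: "'a \<Rightarrow> real" where
  "L w = (let p = (SOME p. p \<in> Q \<and> p - w \<in> Q) in u p - u (p - w))"

text \<open>Two representations of one vector as a difference become, after adding across, two
  decompositions of one point of \<open>Q\<close>, on which \<open>u\<close> is additive.\<close>

lemma L_diff:
  assumes p: "p \<in> Q" "p' \<in> Q"
  shows "L (p - p') = u p - u p'"
proof -
  define q where "q = (SOME q. q \<in> Q \<and> q - (p - p') \<in> Q)"
  have "p \<in> Q \<and> p - (p - p') \<in> Q" using p by simp
  then have q: "q \<in> Q" "q - (p - p') \<in> Q"
    using someI[of "\<lambda>q. q \<in> Q \<and> q - (p - p') \<in> Q" p] by (auto simp: q_def)
  have "u (p + (q - (p - p'))) = u (q + p')" by (simp add: algebra_simps)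
  then have "u p + u (q - (p - p')) = u q + u p'" using u_add p q by metis
  then show ?thesis by (simp add: L_def q_def[symmetric] Let_def)
qed

lemma L_linear: "linear L"
proof (rule linearI)
  fix v w
  obtain p p' where p: "p \<in> Q" "p' \<in> Q" "v = p - p'" by (rule diff_of_Q)
  obtain q q' where q: "q \<in> Q" "q' \<in> Q" "w = q - q'" by (rule diff_of_Q)
  have "v + w = (p + q) - (p' + q')" by (simp add: p q)
  then have "L (v + w) = u (p + q) - u (p' + q')" using L_diff p q Q_add by metis
  then show "L (v + w) = L v + L w" using p q by (simp add: L_diff u_add)
next
  fix r :: real and v
  obtain p p' where p: "p \<in> Q" "p' \<in> Q" "v = p - p'" by (rule diff_of_Q)
  consider "0 < r" | "r = 0" | "r < 0" by linarith
  then show "L (r *\<^sub>R v) = r *\<^sub>R L v"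
  proof cases
    case 1
    have "r *\<^sub>R v = r *\<^sub>R p - r *\<^sub>R p'" by (simp add: p scaleR_diff_right)
    then have "L (r *\<^sub>R v) = u (r *\<^sub>R p) - u (r *\<^sub>R p')" using L_diff Q_scale p 1 by simp
    also have "\<dots> = r *\<^sub>R L v" using p 1 by (simp add: L_diff u_scale right_diff_distrib)
    finally show ?thesis .
  next
    case 2
    have "L (p - p) = 0" using L_diff[OF p(1) p(1)] by simp
    then show ?thesis using 2 by simp
  next
    case 3
    \<comment> \<open>A negative factor exchanges the roles of \<open>p\<close> and
      \<open>p'\<close>, so that only positive multiples occur.\<close>
    define s where "s = - r"
    have "0 < s" "r *\<^sub>R v = s *\<^sub>R p' - s *\<^sub>R p" using 3 by (simp_all add: s_def p algebra_simps)
    then have "L (r *\<^sub>R v) = s * u p' - s * u p" using p by (simp add: L_diff Q_scale u_scale)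
    also have "\<dots> = r *\<^sub>R L v" using p by (simp add: s_def L_diff right_diff_distrib)
    finally show ?thesis .
  qed
qed

lemma u_eq_L: "q \<in> Q \<Longrightarrow> u q = L q"
  using L_diff[of "q + q" q] Q_add[of q q] u_add[of q q] by simp

text \<open>If \<open>L x\<close> were not positive, translation by \<open>x\<close> would not
  decrease \<open>g\<close>, and the progression from \<open>q\<close> in direction \<open>x\<close>
  would stay in a bounded superlevel set.\<close>

lemma L_pos:
  assumes x: "x \<in> closure Q" "x \<noteq> 0"
  shows "0 < L x"
proof (rule ccontr)
  assume "\<not> 0 < L x"
  obtain q where q: "q \<in> Q" using Q by blast
  have "q + real k *\<^sub>R x \<in> Q \<and> g q \<le> g (q + real k *\<^sub>R x)" for k :: nat
  proof (induction k)
    case (Suc k)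
    let ?y = "q + real k *\<^sub>R x"
    have y: "?y \<in> Q" and "g q \<le> g ?y" using Suc by auto
    have yx: "?y + x \<in> Q" using Q_add_closure[OF y x(1)] .
    have "u (?y + x) = u ?y + L x"
      using y yx by (simp add: u_eq_L linear_add[OF L_linear])
    then have "g ?y \<le> g (?y + x)" using y yx a_pos \<open>\<not> 0 < L x\<close> by (simp add: g_eq)
    moreover have "q + real (Suc k) *\<^sub>R x = ?y + x" by (simp add: algebra_simps)
    ultimately show ?case using yx \<open>g q \<le> g ?y\<close> by (metis order.trans)
  qed (simp add: q)
  then have "x = 0" using superlevel_ray[OF q] by blast
  then show False using x by simp
qed

text \<open>The contact point \<open>x0\<close> for the difference \<open>w\<close> is the supremum
  of \<open>0\<close> and \<open>w\<close>: membership of \<open>x0\<close> and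
  \<open>x1 = x0 - w\<close> in the closure makes it an upper bound, and the contact inclusion makes
  it the least one.\<close>

sublocale lattice_cone "closure Q" L
proof (rule lattice_cone.intro)
  obtain q where q: "q \<in> Q" using Q by blast
  show "x + y \<in> closure Q" if "x \<in> closure Q" "y \<in> closure Q" for x y
  proof (rule in_closure_Q[OF q])
    fix t :: real assume "0 < t"
    then have "t *\<^sub>R q + x \<in> Q" using Q_scale q Q_add_closure that by blast
    then have "t *\<^sub>R q + x + y \<in> Q" using Q_add_closure that by blast
    then show "x + y + t *\<^sub>R q \<in> Q" by (simp add: add_ac)
  qed
  show "t *\<^sub>R x \<in> closure Q" if "x \<in> closure Q" "0 \<le> t" for x t
  proof (cases "t = 0")
    case False
    then have t: "0 < t" using that by simp
    show ?thesis
    proof (rule in_closure_Q[OF q])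
      fix s :: real assume s: "0 < s"
      then have "(s / t) *\<^sub>R q + x \<in> Q" using Q_scale q Q_add_closure that t by simp
      then have "t *\<^sub>R ((s / t) *\<^sub>R q + x) \<in> Q" using Q_scale t by blast
      then show "t *\<^sub>R x + s *\<^sub>R q \<in> Q" using t by (simp add: scaleR_add_right add.commute)
    qed
  qed (simp add: Q)
  show "closed (closure Q)" by simp
  show "span (closure Q) = UNIV"
  proof (rule set_eqI, rule iffI[OF UNIV_I])
    fix w
    obtain p p' where p: "p \<in> Q" "p' \<in> Q" "w = p - p'" by (rule diff_of_Q)
    show "w \<in> span (closure Q)"
      unfolding p(3) using p closure_subset[of Q] by (intro span_diff span_base) auto
  qed
  show "linear L" by (rule L_linear)
  show "0 < L x" if "x \<in> closure Q" "x \<noteq> 0" for x using that by (rule L_pos)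
  fix w
  show "\<exists>c\<in>closure Q. c - w \<in> closure Q \<and> (\<forall>y\<in>closure Q. y - w \<in> closure Q \<longrightarrow> y - c \<in> closure Q)"
  proof -
    obtain x0 a0 x1 a1 where x: "x0 - x1 = w" "x0 \<in> closure Q" "x1 \<in> closure Q"
      "\<And>x. x + x0 \<in> Q \<Longrightarrow> x + x1 \<in> Q \<Longrightarrow> x \<in> Q"
      by (rule touch_cone[of w]) (rule that)
    have x1: "x1 = x0 - w" using x(1) by (simp add: algebra_simps)
    have "y - x0 \<in> closure Q" if y: "y \<in> closure Q" "y - w \<in> closure Q" for y
    \<comment> \<open>The contact inclusion concerns the open cone, so the points are first pushed
      inside by \<open>t *\<^sub>R q\<close>.\<close>
    proof (rule in_closure_Q[OF q], rule x(4))
      fix t :: real assume t: "0 < t"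
      show "y - x0 + t *\<^sub>R q + x0 \<in> Q"
        using Q_add_closure[OF Q_scale[OF q t] y(1)] by (simp add: algebra_simps)
      show "y - x0 + t *\<^sub>R q + x1 \<in> Q"
        using Q_add_closure[OF Q_scale[OF q t] y(2)] by (simp add: algebra_simps x1)
    qed
    then show ?thesis using x by (intro bexI[of _ x0]) (auto simp: x1)
  qed
qed

lemma g_eq_exp: "x \<in> Q \<Longrightarrow> g x = a * exp (- L x)"
  by (simp add: g_eq u_eq_L)

lemma Q_eq_interior: "Q = interior (closure Q)"
  using convex_interior_closure[OF Q(2)] interior_open[OF Q(1)] by simp

end

subsection \<open>The autocorrelation of a log-concave function\<close>

locale integrable_log_concave =
  fixes f :: "'a::euclidean_space \<Rightarrow> real"
  assumes nonneg: "\<And>x. 0 \<le> f x"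
    and lc: "log_concave f"
    and integrable: "integrable lebesgue f"
    and interior_nonempty: "interior (positivity_set f) \<noteq> {}"
begin

section \<open>The positivity set, continuity inside it, and truncation to its interior\<close>

definition P :: "'a set" where "P = interior (positivity_set f)"

lemma f_convex_comb: "t \<in> {0..1} \<Longrightarrow> f x powr (1 - t) * f y powr t \<le> f ((1 - t) *\<^sub>R x + t *\<^sub>R y)"
  using lc by (auto simp: log_concave_def)

lemma f_midpoint: "sqrt (f x * f y) \<le> f ((1/2) *\<^sub>R (x + y))"
  using f_convex_comb[of "1/2" x y] nonneg
  by (simp add: powr_half_sqrt real_sqrt_mult scaleR_add_right)

lemma convex_positivity_set: "convex (positivity_set f)"
proof (rule convexI)
  fix x y and u v :: real
  assume "x \<in> positivity_set f" "y \<in> positivity_set f" and uv: "0 \<le> u" "0 \<le> v" "u + v = 1"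
  then have "0 < f x powr (1 - v) * f y powr v" by (simp add: positivity_set_def)
  also have "\<dots> \<le> f ((1 - v) *\<^sub>R x + v *\<^sub>R y)" using uv by (intro f_convex_comb) auto
  finally show "u *\<^sub>R x + v *\<^sub>R y \<in> positivity_set f"
    using uv by (simp add: positivity_set_def eq_diff_eq[symmetric])
qed

lemma open_P: "open P" and P_nonempty: "P \<noteq> {}"
  and convex_P: "convex P" and closure_P: "closure P = closure (positivity_set f)"
  using interior_nonempty convex_positivity_set
  by (simp_all add: P_def convex_interior convex_closure_interior)

lemma interior_closure_P: "interior (closure P) = P"
  using convex_interior_closure[OF convex_P] interior_open[OF open_P] by simp

lemma f_pos: "x \<in> P \<Longrightarrow> 0 < f x"
  using interior_subset by (auto simp: P_def positivity_set_def)

lemma in_closure_P: "0 < f x \<Longrightarrow> x \<in> closure P"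
  unfolding closure_P by (rule subsetD[OF closure_subset]) (simp add: positivity_set_def)

lemma midpoint_in_P:
  assumes "x \<in> P" "y \<in> closure P"
  shows "(1/2) *\<^sub>R (x + y) \<in> P"
proof -
  have "y - (1/2) *\<^sub>R (y - x) \<in> interior P"
    using assms convex_P open_P by (intro mem_interior_closure_convex_shrink) (auto simp: interior_open)
  moreover have "y - (1/2) *\<^sub>R (y - x) = (1/2) *\<^sub>R (x + y)"
  proof -
    have "y - (1/2) *\<^sub>R (y - x) = (y - (1/2) *\<^sub>R y) + (1/2) *\<^sub>R x" by (simp add: scaleR_diff_right)
    also have "y - (1/2) *\<^sub>R y = (1 - 1/2) *\<^sub>R y" by (simp only: scaleR_left_diff_distrib scaleR_one)
    finally show ?thesis by (simp add: scaleR_add_right add.commute)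
  qed
  ultimately show ?thesis using interior_subset by auto
qed

text \<open>On the open convex set \<open>P\<close> the function \<open>- ln f\<close> is finite and
  convex, hence continuous.\<close>

lemma continuous_on_f: "continuous_on P f"
proof -
  have "convex_on P (\<lambda>x. - ln (f x))"
  proof (rule convex_onI)
    fix t :: real and x y assume t: "0 < t" "t < 1" and xy: "x \<in> P" "y \<in> P"
    have "(1 - t) * ln (f x) + t * ln (f y) = ln (f x powr (1 - t) * f y powr t)"
      using f_pos[OF xy(1)] f_pos[OF xy(2)] by (simp add: ln_mult ln_powr)
    also have "\<dots> \<le> ln (f ((1 - t) *\<^sub>R x + t *\<^sub>R y))"
      using f_pos[OF xy(1)] f_pos[OF xy(2)] t f_convex_comb[of t x y]
      by (intro ln_mono) auto
    finally show "- ln (f ((1 - t) *\<^sub>R x + t *\<^sub>R y)) \<le> (1 - t) * - ln (f x) + t * - ln (f y)"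
      by simp
  qed (rule convex_P)
  then have "continuous_on P (\<lambda>x. - ln (f x))"
    using convex_on_continuous open_P by blast
  then have "continuous_on P (\<lambda>x. exp (- (- ln (f x))))"
    by (rule continuous_on_exp[OF continuous_on_minus])
  then show ?thesis
    by (rule continuous_on_cong[THEN iffD1, rotated -1]) (use f_pos in auto)
qed

lemma tendsto_f: "x \<in> P \<Longrightarrow> (X \<longlongrightarrow> x) net \<Longrightarrow> ((\<lambda>k. f (X k)) \<longlongrightarrow> f x) net"
  using continuous_on_f open_P by (metis continuous_on_eq_continuous_at isCont_tendsto_compose)

text \<open>Truncation to \<open>P\<close> discards the boundary values of \<open>f\<close>, which
  can be arbitrary enough to destroy Borel measurability; \<open>fP\<close> is Borel because
  \<open>f\<close> is continuous on the open set \<open>P\<close>.\<close>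

definition fP :: "'a \<Rightarrow> real" where "fP x = indicator P x * f x"

lemma fP_simps: "x \<in> P \<Longrightarrow> fP x = f x" "x \<notin> P \<Longrightarrow> fP x = 0"
  by (simp_all add: fP_def)

lemma fP_nonneg: "0 \<le> fP x"
  by (simp add: fP_def nonneg)

lemma fP_measurable [measurable]: "fP \<in> borel_measurable borel"
  using borel_measurable_continuous_on_indicator[OF _ continuous_on_f] open_P
  by (simp add: fP_def[abs_def])

text \<open>The two functions can differ only on the frontier of a convex set, which is
  negligible.\<close>

lemma AE_f_eq_fP: "AE x in lebesgue. f x = fP x"
proof -
  have "negligible (frontier (positivity_set f))"
    by (rule negligible_convex_frontier[OF convex_positivity_set])
  then have "AE x in lebesgue. x \<notin> frontier (positivity_set f)"
    by (simp add: negligible_iff_null_sets AE_not_in)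
  then show ?thesis
  proof (rule AE_mp, intro AE_I2 impI)
    fix x assume "x \<notin> frontier (positivity_set f)"
    then have "x \<in> P \<or> x \<notin> closure (positivity_set f)"
      by (auto simp: frontier_def P_def)
    then show "f x = fP x"
      using in_closure_P[of x] nonneg[of x] closure_P by (cases "f x = 0") (auto simp: fP_def)
  qed
qed

section \<open>Total mass and autocorrelation, and the resulting bound for the difference
  function\<close>

definition mass :: ennreal where "mass = (\<integral>\<^sup>+x. fP x \<partial>lborel)"

lemma nn_integral_f: "(\<integral>\<^sup>+x. f x \<partial>lebesgue) = mass"
proof -
  have "(\<integral>\<^sup>+x. f x \<partial>lebesgue) = (\<integral>\<^sup>+x. fP x \<partial>lebesgue)"
    using AE_f_eq_fP by (intro nn_integral_cong_AE) auto
  then show ?thesis by (simp add: mass_def nn_integral_completion)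
qed

lemma mass_finite: "mass \<noteq> \<infinity>"
  using integrable nonneg unfolding nn_integral_f[symmetric] integrable_iff_bounded by (simp add: less_top)

lemma mass_nonzero: "mass \<noteq> 0"
proof
  assume "mass = 0"
  then have "AE x in lborel. fP x = 0"
    unfolding mass_def by (subst (asm) nn_integral_0_iff_AE) (auto simp: fP_nonneg ennreal_eq_0_iff order_antisym)
  then obtain x where "x \<in> P" "fP x = 0" 
    using AE_lborel_open_obtain open_P P_nonempty by blast
  then show False using f_pos[of x] by (simp add: fP_simps)
qed

definition correlation :: "'a \<Rightarrow> ennreal" where
  "correlation z = (\<integral>\<^sup>+y. ennreal (fP y * fP (y - z)) \<partial>lborel)"

definition correlation_bound :: "'a \<Rightarrow> ennreal" where "correlation_bound z = 2 ^ DIM('a) * correlation z / mass"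

lemma correlation_measurable [measurable]: "correlation \<in> borel_measurable borel"
  unfolding correlation_def[abs_def] by measurable

lemma correlation_bound_measurable [measurable]: "correlation_bound \<in> borel_measurable borel"
  unfolding correlation_bound_def[abs_def] by measurable

lemma mass_mult_correlation_bound: "mass * correlation_bound z = 2 ^ DIM('a) * correlation z"
  using mass_nonzero mass_finite mult_divide_eq_ennreal[of mass "2 ^ DIM('a) * correlation z"]
  by (simp add: correlation_bound_def mult.commute ennreal_times_divide)

text \<open>Tonelli's theorem, with the inner integral evaluated by the reflection that sends
  \<open>z\<close> to \<open>y - z\<close>.\<close>

lemma nn_integral_correlation: "(\<integral>\<^sup>+z. correlation z \<partial>lborel) = mass * mass"
proof -
  have inner: "(\<integral>\<^sup>+z. fP (y - z) \<partial>lborel) = mass" for y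
    unfolding mass_def using nn_integral_lborel_affine[of "\<lambda>z. ennreal (fP z)" "-1" y] by simp
  have "(\<integral>\<^sup>+z. correlation z \<partial>lborel) = (\<integral>\<^sup>+y. (\<integral>\<^sup>+z. ennreal (fP y * fP (y - z)) \<partial>lborel) \<partial>lborel)"
    unfolding correlation_def by (rule lborel_pair.Fubini') measurable
  also have "\<dots> = (\<integral>\<^sup>+y. ennreal (fP y) * mass \<partial>lborel)"
    by (simp add: ennreal_mult fP_nonneg nn_integral_cmult inner)
  also have "\<dots> = mass * mass"
    by (simp add: nn_integral_multc mass_def)
  finally show ?thesis .
qed

lemma nn_integral_correlation_bound: "(\<integral>\<^sup>+z. correlation_bound z \<partial>lborel) = 2 ^ DIM('a) * mass"
proof -
  have "(\<integral>\<^sup>+z. correlation_bound z \<partial>lborel) = 2 ^ DIM('a) * (mass * mass) / mass"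
    unfolding correlation_bound_def by (simp add: nn_integral_divide nn_integral_cmult nn_integral_correlation)
  then show ?thesis
    using mass_nonzero mass_finite mult_divide_eq_ennreal[of mass "2 ^ DIM('a) * mass"] by (simp add: mult.assoc)
qed

text \<open>Substituting the midpoint of \<open>x\<close> and \<open>x0\<close> for the variable of
  the autocorrelation produces the Jacobian factor \<open>2 ^ DIM('a)\<close>.\<close>

lemma nn_integral_midpoints:
  "(\<integral>\<^sup>+x. ennreal (fP ((1/2) *\<^sub>R (x + x0)) * fP ((1/2) *\<^sub>R (x + x1))) \<partial>lborel)
    = 2 ^ DIM('a) * correlation ((1/2) *\<^sub>R (x0 - x1))"
    (is "?I = _")
proof -
  let ?z = "(1/2) *\<^sub>R (x0 - x1)"
  have *: "(1/2) *\<^sub>R x0 + (1/2) *\<^sub>R x - ?z = (1/2) *\<^sub>R (x + x1)" for x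
    by (simp add: algebra_simps)
  have **: "(1/2) *\<^sub>R x0 + (1/2) *\<^sub>R x = (1/2) *\<^sub>R (x + x0)" for x
    by (simp add: algebra_simps)
  have "correlation ?z = ennreal (\<bar>1/2\<bar> ^ DIM('a)) *
      (\<integral>\<^sup>+x. ennreal (fP ((1/2) *\<^sub>R x0 + (1/2) *\<^sub>R x) * fP ((1/2) *\<^sub>R x0 + (1/2) *\<^sub>R x - ?z)) \<partial>lborel)"
    unfolding correlation_def by (rule nn_integral_lborel_affine) auto
  also have "\<dots> = ennreal ((1/2) ^ DIM('a)) * ?I"
    unfolding * unfolding ** by simp
  finally have "2 ^ DIM('a) * correlation ?z = (ennreal (2 ^ DIM('a)) * ennreal ((1/2) ^ DIM('a))) * ?I"
    by (simp add: mult.assoc ennreal_power[symmetric])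
  also have "ennreal (2 ^ DIM('a)) * ennreal ((1/2) ^ DIM('a)) = 1"
    by (simp add: ennreal_mult[symmetric] power_mult_distrib[symmetric])
  finally show ?thesis by simp
qed

text \<open>The product of two midpoint inequalities. If the left side is nonzero, \<open>x\<close>
  lies in \<open>P\<close> and \<open>x0\<close>, \<open>x1\<close> in its closure, so truncation
  does not affect the midpoints.\<close>

lemma fP_midpoints: "fP x * sqrt (f x0 * f x1) \<le> fP ((1/2) *\<^sub>R (x + x0)) * fP ((1/2) *\<^sub>R (x + x1))"
proof (cases "x \<in> P \<and> 0 < f x0 \<and> 0 < f x1")
  case True
  then have "(1/2) *\<^sub>R (x + x0) \<in> P" "(1/2) *\<^sub>R (x + x1) \<in> P"
    using midpoint_in_P in_closure_P by auto
  moreover have "f x * sqrt (f x0 * f x1) = sqrt (f x * f x0) * sqrt (f x * f x1)"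
    using nonneg[of x] by (simp add: real_sqrt_mult)
  moreover have "\<dots> \<le> f ((1/2) *\<^sub>R (x + x0)) * f ((1/2) *\<^sub>R (x + x1))"
    by (intro mult_mono f_midpoint) (auto simp: nonneg)
  ultimately show ?thesis using True by (simp add: fP_simps)
next
  case False
  then have "fP x * sqrt (f x0 * f x1) = 0"
    using nonneg[of x0] nonneg[of x1] fP_simps(2)[of x] by (auto simp: order.order_iff_strict)
  then show ?thesis using fP_nonneg by (metis mult_nonneg_nonneg)
qed

text \<open>Integrate \<open>fP_midpoints\<close> over the free point, with \<open>x\<close> and
  \<open>- y\<close> as the fixed pair; their difference is \<open>2 *\<^sub>R z\<close>.\<close>

lemma difference_function_le: "difference_function f z \<le> correlation_bound z"
  unfolding difference_function_def
proof (rule Sup_least, clarify)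
  fix x y assume z: "z = (1/2) *\<^sub>R (x + y)"
  have "ennreal (sqrt (f x * f (- y))) * mass = (\<integral>\<^sup>+t. ennreal (sqrt (f x * f (- y))) * fP t \<partial>lborel)"
    by (simp add: mass_def nn_integral_cmult)
  also have "\<dots> \<le> (\<integral>\<^sup>+t. ennreal (fP ((1/2) *\<^sub>R (t + x)) * fP ((1/2) *\<^sub>R (t + (- y)))) \<partial>lborel)"
    using fP_midpoints[of _ x "- y"]
    by (intro nn_integral_mono) (simp add: ennreal_mult[symmetric] nonneg fP_nonneg mult.commute)
  also have "\<dots> = 2 ^ DIM('a) * correlation ((1/2) *\<^sub>R (x + y))"
    by (subst nn_integral_midpoints) simp
  finally have "ennreal (sqrt (f x * f (- y))) * mass / mass \<le> correlation_bound ((1/2) *\<^sub>R (x + y))"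
    unfolding correlation_bound_def by (rule divide_right_mono_ennreal)
  then show "ennreal (sqrt (f x * f (- y))) \<le> correlation_bound ((1/2) *\<^sub>R (x + y))"
    using mass_nonzero mass_finite by (simp add: mult_divide_eq_ennreal)
qed

section \<open>Boundedness of \<open>f\<close> and of its superlevel sets\<close>

lemma ball_lower_bound:
  obtains q r c where "0 < r" "0 < c"
    "\<And>x y. 0 < f x \<Longrightarrow> y \<in> ball ((1/2) *\<^sub>R (q + x)) (r / 2) \<Longrightarrow> sqrt (c * f x) \<le> fP y"
proof -
  obtain q where q: "q \<in> P" using P_nonempty by blast
  have "((\<lambda>x. f x) \<longlongrightarrow> f q) (at q)" by (rule tendsto_f[OF q tendsto_ident_at])
  then have "\<forall>\<^sub>F x in at q. f q / 2 < f x" using f_pos[OF q] by (intro order_tendstoD) auto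
  moreover have "\<forall>\<^sub>F x in at q. x \<in> P" using q open_P eventually_at_topological by blast
  ultimately have "\<forall>\<^sub>F x in at q. f q / 2 < f x \<and> x \<in> P" by eventually_elim auto
  then obtain r where r: "0 < r" "\<And>x. x \<noteq> q \<Longrightarrow> dist x q < r \<Longrightarrow> f q / 2 < f x \<and> x \<in> P"
    unfolding eventually_at by auto
  have r': "f q / 2 < f x \<and> x \<in> P" if "dist x q < r" for x
    using r(2)[OF _ that] q f_pos[OF q] by (cases "x = q") auto
  show ?thesis
  proof (rule that[of r "f q / 2" q])
    fix x y assume x: "0 < f x" and y: "y \<in> ball ((1/2) *\<^sub>R (q + x)) (r / 2)"
    \<comment> \<open>The point \<open>y\<close> is the midpoint of \<open>u\<close> and
      \<open>x\<close>, and \<open>u\<close> is within \<open>r\<close> of \<open>q\<close>, where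
      \<open>f\<close> exceeds \<open>f q / 2\<close>.\<close>
    define u where "u = 2 *\<^sub>R y - x"
    have "u - q = 2 *\<^sub>R (y - (1/2) *\<^sub>R (q + x))" by (simp add: u_def algebra_simps)
    then have "dist u q = 2 * dist y ((1/2) *\<^sub>R (q + x))" by (simp only: dist_norm norm_scaleR)
    then have u: "f q / 2 < f u" "u \<in> P" using r'[of u] y by (auto simp: dist_commute)
    have yu: "y = (1/2) *\<^sub>R (u + x)" by (simp add: u_def)
    have "sqrt (f q / 2 * f x) \<le> sqrt (f u * f x)" using u x by (intro real_sqrt_le_mono mult_right_mono) auto
    also have "\<dots> \<le> f y" unfolding yu by (rule f_midpoint)
    also have "f y = fP y" using midpoint_in_P[OF u(2) in_closure_P[OF x]] by (simp add: fP_simps yu)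
    finally show "sqrt (f q / 2 * f x) \<le> fP y" .
  qed (use r f_pos[OF q] in auto)
qed

text \<open>The lower bound is integrated over a ball whose volume does not depend on
  \<open>x\<close>. Taking the whole space for \<open>T\<close> bounds \<open>f\<close>; taking the
  exterior of a large ball bounds the superlevel sets.\<close>

lemma superlevel_tail_bound:
  obtains q r c where "0 < r" "0 < c"
    "\<And>x T. 0 < f x \<Longrightarrow> T \<in> sets borel \<Longrightarrow> ball ((1/2) *\<^sub>R (q + x)) (r / 2) \<subseteq> T \<Longrightarrow>
      ennreal (c * sqrt (f x)) \<le> (\<integral>\<^sup>+y. ennreal (fP y) * indicator T y \<partial>lborel)"
proof -
  obtain q r c where r: "0 < r" and c: "0 < c" and
    low: "\<And>x y. 0 < f x \<Longrightarrow> y \<in> ball ((1/2) *\<^sub>R (q + x)) (r / 2) \<Longrightarrow> sqrt (c * f x) \<le> fP y"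
    by (rule ball_lower_bound) (rule that)
  define V where "V = unit_ball_vol (real DIM('a)) * (r / 2) ^ DIM('a)"
  have V: "0 < V" using r unfolding V_def by (intro mult_pos_pos unit_ball_vol_pos) auto
  show ?thesis
  proof (rule that[of r "sqrt c * V" q])
    fix x T assume x: "0 < f x" and [measurable]: "T \<in> sets borel"
      and T: "ball ((1/2) *\<^sub>R (q + x)) (r / 2) \<subseteq> T"
    let ?B = "ball ((1/2) *\<^sub>R (q + x)) (r / 2)"
    have "ennreal (sqrt c * V * sqrt (f x)) = ennreal (sqrt (c * f x)) * emeasure lborel ?B"
      using r V c x by (simp add: emeasure_ball V_def[symmetric] ennreal_mult[symmetric] real_sqrt_mult mult_ac)
    also have "\<dots> = (\<integral>\<^sup>+y. ennreal (sqrt (c * f x)) * indicator ?B y \<partial>lborel)"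
      by (subst nn_integral_cmult_indicator) auto
    also have "\<dots> \<le> (\<integral>\<^sup>+y. ennreal (fP y) * indicator T y \<partial>lborel)"
      using low[OF x] T by (intro nn_integral_mono) (auto simp: indicator_def fP_nonneg intro!: ennreal_leI)
    finally show "ennreal (sqrt c * V * sqrt (f x)) \<le> (\<integral>\<^sup>+y. ennreal (fP y) * indicator T y \<partial>lborel)" .
  qed (use r c V in auto)
qed

lemma f_bounded: obtains M where "0 < M" "\<And>x. f x \<le> M"
proof -
  obtain q r c where c: "0 < c" and
    low: "\<And>x T. 0 < f x \<Longrightarrow> T \<in> sets borel \<Longrightarrow> ball ((1/2) *\<^sub>R (q + x)) (r / 2) \<subseteq> T \<Longrightarrow>
      ennreal (c * sqrt (f x)) \<le> (\<integral>\<^sup>+y. ennreal (fP y) * indicator T y \<partial>lborel)"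
    by (rule superlevel_tail_bound) (rule that)
  obtain n where n: "mass = ennreal n" "0 \<le> n" using mass_finite by (cases mass) auto
  have "f x \<le> (n / c)\<^sup>2 + 1" for x
  proof (cases "0 < f x")
    case True
    have "ennreal (c * sqrt (f x)) \<le> ennreal n"
      using low[OF True, of UNIV] by (simp add: mass_def[symmetric] n)
    then have "sqrt (f x) \<le> n / c" using n(2) c by (simp add: field_simps)
    then have "(sqrt (f x))\<^sup>2 \<le> (n / c)\<^sup>2" using nonneg[of x] by (intro power_mono) auto
    then show ?thesis using nonneg[of x] by simp
  next
    case False
    then show ?thesis using zero_le_power2[of "n / c"] by linarith
  qed
  then show ?thesis by (intro that[of "(n / c)\<^sup>2 + 1"]) (auto simp: add_nonneg_pos)
qed

text \<open>The finite measure with density \<open>fP\<close> gives arbitrarily small mass to the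
  exterior of large balls, whereas a remote point with \<open>e \<le> f x\<close> would force mass
  at least \<open>c * sqrt e\<close> there.\<close>

lemma bounded_superlevel:
  assumes e: "0 < e"
  shows "bounded {x. e \<le> f x}"
proof -
  obtain q r c where r: "0 < r" and c: "0 < c" and
    low: "\<And>x T. 0 < f x \<Longrightarrow> T \<in> sets borel \<Longrightarrow> ball ((1/2) *\<^sub>R (q + x)) (r / 2) \<subseteq> T \<Longrightarrow>
      ennreal (c * sqrt (f x)) \<le> (\<integral>\<^sup>+y. ennreal (fP y) * indicator T y \<partial>lborel)"
    by (rule superlevel_tail_bound) (rule that)
  define \<nu> where "\<nu> = density lborel fP"
  have \<nu>: "emeasure \<nu> T = (\<integral>\<^sup>+y. ennreal (fP y) * indicator T y \<partial>lborel)" if "T \<in> sets borel" for T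
    unfolding \<nu>_def using that by (subst emeasure_density) auto
  define T where "T k = - ball (0::'a) (real k)" for k
  have T: "T k \<in> sets borel" for k by (simp add: T_def)
  have "(\<lambda>k. emeasure \<nu> (T k)) \<longlonglongrightarrow> emeasure \<nu> (\<Inter>k. T k)"
  proof (rule Lim_emeasure_decseq)
    show "range T \<subseteq> sets \<nu>" using T by (auto simp: \<nu>_def)
    show "decseq T" by (auto simp: decseq_def T_def)
    have "emeasure \<nu> (T k) \<le> mass" for k
      unfolding \<nu>[OF T] mass_def by (intro nn_integral_mono) (auto simp: indicator_def)
    then show "emeasure \<nu> (T k) \<noteq> \<infinity>" for k using mass_finite by (metis infinity_ennreal_def top.extremum_uniqueI)
  qed
  moreover have "(\<Inter>k. T k) = {}"
  proof -
    have "\<exists>k. x \<notin> T k" for x using reals_Archimedean2[of "norm x"] by (auto simp: T_def)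
    then show ?thesis by blast
  qed
  ultimately have "(\<lambda>k. emeasure \<nu> (T k)) \<longlonglongrightarrow> 0" by simp
  then have "\<forall>\<^sub>F k in sequentially. emeasure \<nu> (T k) < ennreal (c * sqrt e)"
    using c e by (intro order_tendstoD) auto
  then obtain k where k: "emeasure \<nu> (T k) < ennreal (c * sqrt e)"
    using eventually_sequentially by auto
  \<comment> \<open>Beyond this radius the centre \<open>(1/2) *\<^sub>R (q + x)\<close> has norm
    above \<open>k + r / 2\<close>, so its ball of radius \<open>r / 2\<close> avoids the ball of
    radius \<open>k\<close> about the origin.\<close>
  have "norm x \<le> 2 * real k + r + norm q" if x: "e \<le> f x" for x
  proof (rule ccontr)
    assume "\<not> ?thesis"
    then have far: "2 * real k + r + norm q < norm x" by simp
    have "ball ((1/2) *\<^sub>R (q + x)) (r / 2) \<subseteq> T k"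
    proof
      fix y assume y: "y \<in> ball ((1/2) *\<^sub>R (q + x)) (r / 2)"
      have "norm x \<le> norm (q + x) + norm q"
        using norm_triangle_ineq4[of "q + x" q] by simp
      moreover have "norm ((1/2) *\<^sub>R (q + x)) \<le> norm y + dist ((1/2) *\<^sub>R (q + x)) y"
        unfolding dist_norm by (rule norm_triangle_sub)
      ultimately show "y \<in> T k" using y far by (auto simp: T_def)
    qed
    then have "ennreal (c * sqrt (f x)) \<le> emeasure \<nu> (T k)"
      using low[of x "T k"] x e T \<nu> by auto
    moreover have "ennreal (c * sqrt e) \<le> ennreal (c * sqrt (f x))"
      using x c by (intro ennreal_leI) auto
    ultimately show False using k by auto
  qed
  then show ?thesis by (auto simp: bounded_iff)
qed

text \<open>Equality in the midpoint inequality between \<open>x\<close> and \<open>c\<close>, with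
  a number \<open>a\<close> in place of \<open>f c\<close>: the point \<open>c\<close> may lie on
  the boundary of \<open>P\<close>, where \<open>f\<close> can jump.\<close>

definition homothetic :: "'a \<Rightarrow> real \<Rightarrow> bool" where
  "homothetic c a \<longleftrightarrow> c \<in> closure P \<and> 0 < a \<and> (\<forall>x\<in>P. (f ((1/2) *\<^sub>R (x + c)))\<^sup>2 = a * f x)"

text \<open>The last clause is the inclusion \<open>(2 P - x0) \<inter> (2 P - x1) \<subseteq> P\<close>; the reverse one holds because
  \<open>x0\<close> and \<open>x1\<close> lie in the closure of the convex set \<open>P\<close>.\<close>
definition touching :: "'a \<Rightarrow> real \<Rightarrow> 'a \<Rightarrow> real \<Rightarrow> bool" where
  "touching x0 a0 x1 a1 \<longleftrightarrow> homothetic x0 a0 \<and> homothetic x1 a1 \<and>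
    (\<forall>x. (1/2) *\<^sub>R (x + x0) \<in> P \<longrightarrow> (1/2) *\<^sub>R (x + x1) \<in> P \<longrightarrow> x \<in> P)"

section \<open>Contact pairs as limits of maximizing pairs\<close>

lemma tendsto_f_midpoint:
  assumes "x \<in> P" "c \<in> closure P" "(X \<longlongrightarrow> c) net"
  shows "((\<lambda>k. f ((1/2) *\<^sub>R (x + X k))) \<longlongrightarrow> f ((1/2) *\<^sub>R (x + c))) net"
  using assms by (intro tendsto_f midpoint_in_P tendsto_intros)

lemma continuous_on_fP_midpoint:
  assumes "c \<in> closure P"
  shows "continuous_on P (\<lambda>x. fP ((1/2) *\<^sub>R (x + c)))"
proof -
  have "continuous_on P (\<lambda>x. f ((1/2) *\<^sub>R (x + c)))"
    by (rule continuous_on_compose2[OF continuous_on_f])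
       (auto intro!: continuous_intros midpoint_in_P assms)
  then show ?thesis
    by (rule continuous_on_cong[THEN iffD1, rotated -1])
       (auto simp: fP_simps midpoint_in_P assms)
qed

lemma difference_function_ge:
  "ennreal (sqrt (f x * f (x - 2 *\<^sub>R z))) \<le> difference_function f z"
proof -
  have "(1 / 2) *\<^sub>R (x + (2 *\<^sub>R z - x)) = z" by simp
  then have "ennreal (sqrt (f x * f (- (2 *\<^sub>R z - x)))) \<le> difference_function f z"
    unfolding difference_function_def by (intro Sup_upper) blast
  then show ?thesis by simp
qed

text \<open>In a maximizing sequence both values are at most a bound \<open>M\<close> of
  \<open>f\<close> and their product stays above \<open>(d / 2)\<^sup>2\<close>, so \<open>X\<close>
  remains in a bounded superlevel set and a subsequence converges. The midpoint inequalities pass to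
  the limit since their right sides are evaluated inside \<open>P\<close>, where \<open>f\<close> is
  continuous.\<close>

lemma maximizing_limit:
  assumes eq: "difference_function f z = ennreal d" and d: "0 < d"
  obtains x0 x1 a0 a1 where "x0 - x1 = 2 *\<^sub>R z" "x0 \<in> closure P" "x1 \<in> closure P"
    "0 < a0" "0 < a1" "a0 * a1 = d\<^sup>2"
    "\<And>M. (\<And>x. f x \<le> M) \<Longrightarrow> a0 \<le> M \<and> a1 \<le> M"
    "\<And>x. x \<in> P \<Longrightarrow> sqrt (f x * a0) \<le> f ((1/2) *\<^sub>R (x + x0))"
    "\<And>x. x \<in> P \<Longrightarrow> sqrt (f x * a1) \<le> f ((1/2) *\<^sub>R (x + x1))"
proof -
  obtain M where M: "0 < M" "\<And>x. f x \<le> M" by (rule f_bounded) (rule that)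
  let ?S = "{ennreal (sqrt (f x * f (- y))) | x y. (1 / 2) *\<^sub>R (x + y) = z}"
  have up: "sqrt (f x * f (x - 2 *\<^sub>R z)) \<le> d" for x
    using difference_function_ge[of x z] d by (simp add: eq)
  have "\<exists>x. e < sqrt (f x * f (x - 2 *\<^sub>R z))" if e: "0 \<le> e" "e < d" for e
  proof -
    have "ennreal e < Sup ?S" using e eq by (simp add: difference_function_def ennreal_lessI)
    then obtain x y where xy: "z = (1 / 2) *\<^sub>R (x + y)" "ennreal e < ennreal (sqrt (f x * f (- y)))"
      unfolding less_Sup_iff by blast
    have "- y = x - 2 *\<^sub>R z" by (simp add: xy(1))
    then show ?thesis using xy(2) e by (auto simp: ennreal_less_iff)
  qed
  \<comment> \<open>The offset 2 keeps every lower bound at \<open>d / 2\<close> or above.\<close>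
  then have "\<exists>x. d - d / real (k + 2) < sqrt (f x * f (x - 2 *\<^sub>R z))" for k
  proof -
    have "d / real (k + 2) \<le> d / 1" using d by (intro divide_left_mono) auto
    moreover have "0 < d / real (k + 2)" using d by simp
    ultimately show ?thesis by (intro \<open>\<And>e. 0 \<le> e \<Longrightarrow> e < d \<Longrightarrow> \<exists>x. e < sqrt (f x * f (x - 2 *\<^sub>R z))\<close>) auto
  qed
  then obtain X where X: "\<And>k. d - d / real (k + 2) < sqrt (f (X k) * f (X k - 2 *\<^sub>R z))"
    by metis
  have lim: "(\<lambda>k. sqrt (f (X k) * f (X k - 2 *\<^sub>R z))) \<longlonglongrightarrow> d"
  proof (rule tendsto_sandwich[OF _ _ _ tendsto_const])
    have "(\<lambda>k. d - d / real (k + 2)) \<longlonglongrightarrow> d - 0"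
      by (intro tendsto_diff tendsto_const LIMSEQ_ignore_initial_segment lim_const_over_n)
    then show "(\<lambda>k. d - d / real (k + 2)) \<longlonglongrightarrow> d" by simp
  qed (use X up in \<open>auto intro!: always_eventually less_imp_le\<close>)
  have low: "d / 2 < sqrt (f (X k) * f (X k - 2 *\<^sub>R z))" for k
  proof -
    have "d / real (k + 2) \<le> d / 2" using d by (intro divide_left_mono) auto
    then show ?thesis using X[of k] by simp
  qed
  have prod: "(d / 2)\<^sup>2 < f (X k) * f (X k - 2 *\<^sub>R z)" for k
  proof -
    have "(d / 2)\<^sup>2 < (sqrt (f (X k) * f (X k - 2 *\<^sub>R z)))\<^sup>2"
      using low[of k] d by (intro power_strict_mono) auto
    then show ?thesis using nonneg by simp
  qed
  have posX: "0 < f (X k)" "0 < f (X k - 2 *\<^sub>R z)" for k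
    using prod[of k] nonneg[of "X k"] nonneg[of "X k - 2 *\<^sub>R z"] zero_le_power2[of "d / 2"]
    by (auto simp: order.order_iff_strict)
  have bX: "(d / 2)\<^sup>2 / M \<le> f (X k)" for k
  proof -
    have "f (X k) * f (X k - 2 *\<^sub>R z) \<le> f (X k) * M" by (intro mult_left_mono M nonneg)
    then have "(d / 2)\<^sup>2 \<le> f (X k) * M" using prod[of k] by linarith
    then show ?thesis using M(1) by (simp add: field_simps)
  qed
  \<comment> \<open>The values are made to converge along with the points, because \<open>f\<close>
    may be discontinuous at the limit points.\<close>
  define s where "s k = (X k, f (X k), f (X k - 2 *\<^sub>R z))" for k
  have "bounded {x. (d / 2)\<^sup>2 / M \<le> f x}" using d M by (intro bounded_superlevel) auto
  then have "bounded ({x. (d / 2)\<^sup>2 / M \<le> f x} \<times> {0..M} \<times> {0..M})"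
    by (intro bounded_Times) auto
  then have "bounded (range s)"
    by (rule bounded_subset) (auto simp: s_def bX M nonneg)
  then obtain l r where r: "strict_mono r" and "(s \<circ> r) \<longlonglongrightarrow> l"
    using bounded_imp_convergent_subsequence by blast
  moreover obtain x0 a0 a1 where l: "l = (x0, a0, a1)" by (cases l)
  ultimately have "(\<lambda>k. (X (r k), f (X (r k)), f (X (r k) - 2 *\<^sub>R z))) \<longlonglongrightarrow> (x0, a0, a1)"
    by (simp add: s_def o_def)
  from tendsto_fst[OF this] tendsto_fst[OF tendsto_snd[OF this]] tendsto_snd[OF tendsto_snd[OF this]]
  have x0: "(\<lambda>k. X (r k)) \<longlonglongrightarrow> x0" and a0: "(\<lambda>k. f (X (r k))) \<longlonglongrightarrow> a0"
    and a1: "(\<lambda>k. f (X (r k) - 2 *\<^sub>R z)) \<longlonglongrightarrow> a1"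
    by simp_all
  define x1 where "x1 = x0 - 2 *\<^sub>R z"
  have x1: "(\<lambda>k. X (r k) - 2 *\<^sub>R z) \<longlonglongrightarrow> x1"
    unfolding x1_def by (intro tendsto_intros x0)
  have cl: "x0 \<in> closure P" "x1 \<in> closure P"
    using in_closure_P[OF posX(1)] in_closure_P[OF posX(2)]
    by (auto intro!: closed_sequentially[OF closed_closure _ x0] closed_sequentially[OF closed_closure _ x1])
  have "(\<lambda>k. sqrt (f (X (r k)) * f (X (r k) - 2 *\<^sub>R z))) \<longlonglongrightarrow> d"
    using LIMSEQ_subseq_LIMSEQ[OF lim r] by (simp add: o_def)
  moreover have "(\<lambda>k. sqrt (f (X (r k)) * f (X (r k) - 2 *\<^sub>R z))) \<longlonglongrightarrow> sqrt (a0 * a1)"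
    by (intro tendsto_intros a0 a1)
  ultimately have "sqrt (a0 * a1) = d" using LIMSEQ_unique by blast
  moreover have a_nonneg: "0 \<le> a0" "0 \<le> a1"
    using nonneg by (auto intro: LIMSEQ_le_const[OF a0] LIMSEQ_le_const[OF a1])
  ultimately have prod_a: "a0 * a1 = d\<^sup>2" using real_sqrt_pow2[of "a0 * a1"] by simp
  then have "a0 \<noteq> 0" "a1 \<noteq> 0" using d by auto
  show ?thesis
  proof (rule that[of x0 x1 a0 a1])
    show "x0 - x1 = 2 *\<^sub>R z" by (simp add: x1_def)
    show "0 < a0" "0 < a1" using a_nonneg \<open>a0 \<noteq> 0\<close> \<open>a1 \<noteq> 0\<close> by auto
    show "a0 \<le> M' \<and> a1 \<le> M'" if "\<And>x. f x \<le> M'" for M'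
      using that by (auto intro: LIMSEQ_le_const2[OF a0] LIMSEQ_le_const2[OF a1])
    show "sqrt (f x * a0) \<le> f ((1/2) *\<^sub>R (x + x0))" if "x \<in> P" for x
    proof (rule LIMSEQ_le)
      show "(\<lambda>k. sqrt (f x * f (X (r k)))) \<longlonglongrightarrow> sqrt (f x * a0)" by (intro tendsto_intros a0)
      show "(\<lambda>k. f ((1/2) *\<^sub>R (x + X (r k)))) \<longlonglongrightarrow> f ((1/2) *\<^sub>R (x + x0))"
        using that cl(1) x0 by (rule tendsto_f_midpoint)
    qed (use f_midpoint in blast)
    show "sqrt (f x * a1) \<le> f ((1/2) *\<^sub>R (x + x1))" if "x \<in> P" for x
    proof (rule LIMSEQ_le)
      show "(\<lambda>k. sqrt (f x * f (X (r k) - 2 *\<^sub>R z))) \<longlonglongrightarrow> sqrt (f x * a1)" by (intro tendsto_intros a1)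
      show "(\<lambda>k. f ((1/2) *\<^sub>R (x + (X (r k) - 2 *\<^sub>R z)))) \<longlonglongrightarrow> f ((1/2) *\<^sub>R (x + x1))"
        using that cl(2) x1 by (rule tendsto_f_midpoint)
    qed (use f_midpoint in blast)
  qed (use cl prod_a in auto)
qed

lemma difference_function_finite: "difference_function f z \<noteq> \<infinity>"
proof -
  obtain M where M: "0 < M" "\<And>x. f x \<le> M" by (rule f_bounded) (rule that)
  have "difference_function f z \<le> ennreal M"
    unfolding difference_function_def
  proof (rule Sup_least, clarify)
    fix x y
    have "f x * f (- y) \<le> M * M" using M nonneg by (intro mult_mono) auto
    then have "sqrt (f x * f (- y)) \<le> sqrt (M * M)" by (rule real_sqrt_le_mono)
    then show "ennreal (sqrt (f x * f (- y))) \<le> ennreal M" using M by (intro ennreal_leI) simp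
  qed
  then show ?thesis by (auto simp: top_unique)
qed

text \<open>The product \<open>H\<close> of the midpoint values dominates \<open>d * fP\<close> but
  has no larger integral, so the two agree almost everywhere. On \<open>P\<close> continuity makes
  this exact and forces equality in each factor; outside \<open>P\<close> it gives the contact
  inclusion.\<close>

lemma touching_of_equality:
  assumes eq: "correlation_bound z \<le> difference_function f z" and p: "p \<in> P" "p - 2 *\<^sub>R z \<in> P"
    and M: "\<And>x. f x \<le> M"
  obtains x0 a0 x1 a1 where "x0 - x1 = 2 *\<^sub>R z" "touching x0 a0 x1 a1"
    "f p * f (p - 2 *\<^sub>R z) \<le> a0 * a1" "a0 \<le> M" "a1 \<le> M"
proof -
  obtain d where d: "difference_function f z = ennreal d" "0 \<le> d"
    using difference_function_finite by (cases "difference_function f z") auto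
  have pd: "sqrt (f p * f (p - 2 *\<^sub>R z)) \<le> d"
    using difference_function_ge[of p z] d by simp
  moreover have "0 < sqrt (f p * f (p - 2 *\<^sub>R z))" using f_pos p by simp
  ultimately have d0: "0 < d" by linarith
  obtain x0 x1 a0 a1 where x: "x0 - x1 = 2 *\<^sub>R z" "x0 \<in> closure P" "x1 \<in> closure P"
    and a: "0 < a0" "0 < a1" "a0 * a1 = d\<^sup>2"
    and aM: "\<And>M. (\<And>x. f x \<le> M) \<Longrightarrow> a0 \<le> M \<and> a1 \<le> M"
    and low0: "\<And>x. x \<in> P \<Longrightarrow> sqrt (f x * a0) \<le> f ((1/2) *\<^sub>R (x + x0))"
    and low1: "\<And>x. x \<in> P \<Longrightarrow> sqrt (f x * a1) \<le> f ((1/2) *\<^sub>R (x + x1))"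
    using maximizing_limit[OF d(1) d0] by metis
  define H where "H x = fP ((1/2) *\<^sub>R (x + x0)) * fP ((1/2) *\<^sub>R (x + x1))" for x
  have [measurable]: "H \<in> borel_measurable borel" unfolding H_def[abs_def] by measurable
  have sqrts: "sqrt (f x * a0) * sqrt (f x * a1) = d * f x" for x
  proof -
    have "sqrt (f x * a0) * sqrt (f x * a1) = (sqrt (f x) * sqrt (f x)) * sqrt (a0 * a1)"
      by (simp only: real_sqrt_mult mult_ac)
    then show ?thesis using nonneg[of x] d by (simp add: a(3))
  qed
  have H_ge: "d * fP x \<le> H x" for x
  proof (cases "x \<in> P")
    case True
    have "sqrt (f x * a0) * sqrt (f x * a1) \<le> f ((1/2) *\<^sub>R (x + x0)) * f ((1/2) *\<^sub>R (x + x1))"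
      using low0[OF True] low1[OF True] a nonneg by (intro mult_mono) auto
    then show ?thesis using True midpoint_in_P[OF True] x by (simp add: H_def fP_simps sqrts)
  next
    case False
    then show ?thesis by (simp add: H_def fP_nonneg fP_simps(2))
  qed
  have AE: "AE x in lborel. ennreal (H x) \<le> ennreal (d * fP x)"
  proof (rule AE_eq_of_nn_integral_le_measurable)
    have dN: "(\<integral>\<^sup>+x. ennreal (d * fP x) \<partial>lborel) = ennreal d * mass"
      using d by (simp add: mass_def ennreal_mult fP_nonneg nn_integral_cmult)
    have z: "(1/2) *\<^sub>R (x0 - x1) = z" by (simp add: x(1))
    have "(\<integral>\<^sup>+x. ennreal (H x) \<partial>lborel) = mass * correlation_bound z"
      unfolding H_def nn_integral_midpoints z mass_mult_correlation_bound ..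
    also have "\<dots> \<le> mass * ennreal d" using eq d by (intro mult_left_mono) auto
    finally show "(\<integral>\<^sup>+x. ennreal (H x) \<partial>lborel) \<le> (\<integral>\<^sup>+x. ennreal (d * fP x) \<partial>lborel)"
      by (simp add: dN mult.commute)
    show "(\<integral>\<^sup>+x. ennreal (d * fP x) \<partial>lborel) \<noteq> \<infinity>"
      unfolding dN using mass_finite by (simp add: ennreal_mult_eq_top_iff)
  qed (use H_ge in \<open>auto intro!: ennreal_leI\<close>)
  then have AE: "AE x in lborel. H x \<le> d * fP x"
    by (rule AE_mp) (use d fP_nonneg in \<open>auto intro!: AE_I2\<close>)
  have H_eq: "H x = d * f x" if "x \<in> P" for x
  proof (rule ccontr)
    assume neq: "H x \<noteq> d * f x"
    \<comment> \<open>By continuity a strict inequality at one point would persist on a nonempty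
      open set, against the almost-everywhere bound.\<close>
    define V where "V = P \<inter> (\<lambda>x. H x - d * f x) -` {0<..}"
    have "continuous_on P (\<lambda>x. H x - d * f x)"
      unfolding H_def by (intro continuous_intros continuous_on_fP_midpoint continuous_on_f x)
    then have "open V"
      unfolding V_def using open_P by (rule continuous_open_preimage) auto
    moreover have "x \<in> V"
      using neq H_ge[of x] that by (simp add: V_def fP_simps)
    ultimately obtain y where y: "y \<in> V" "H y \<le> d * fP y"
      using AE_lborel_open_obtain[OF AE, of V] by blast
    then have "y \<in> P" "0 < H y - d * f y" by (auto simp: V_def)
    with y(2) show False by (simp add: fP_simps)
  qed
  \<comment> \<open>Two positive lower bounds whose product equals that of the bounded numbers are
    both attained.\<close>
  have tight: "u = u'" "v = v'"
    if "u * v = u' * v'" "u' \<le> u" "v' \<le> v" "0 < u'" "0 < v'" for u v u' v' :: real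
  proof -
    have "u' * v' \<le> u' * v" "u * v' \<le> u * v"
      using that by (linarith | intro mult_left_mono)+
    moreover have "u' * v \<le> u * v" "u' * v' \<le> u * v'"
      using that by (linarith | intro mult_right_mono)+
    ultimately have "u' * v' = u' * v" "u' * v' = u * v'" using that(1) by linarith+
    with that(4,5) show "u = u'" "v = v'" by simp_all
  qed
  have sq: "f ((1/2) *\<^sub>R (y + x0)) = sqrt (f y * a0)" "f ((1/2) *\<^sub>R (y + x1)) = sqrt (f y * a1)"
    if y: "y \<in> P" for y
  proof -
    have "f ((1/2) *\<^sub>R (y + x0)) * f ((1/2) *\<^sub>R (y + x1)) = sqrt (f y * a0) * sqrt (f y * a1)"
      using H_eq[OF y] midpoint_in_P[OF y] x by (simp add: H_def fP_simps sqrts)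
    from tight[OF this] show "f ((1/2) *\<^sub>R (y + x0)) = sqrt (f y * a0)"
        "f ((1/2) *\<^sub>R (y + x1)) = sqrt (f y * a1)"
      using low0[OF y] low1[OF y] f_pos[OF y] a by auto
  qed
  \<comment> \<open>The set where \<open>H\<close> is positive. Almost all of its points lie in
    \<open>P\<close>, so this open set lies in the closure of \<open>P\<close> and hence in
    \<open>P\<close>.\<close>
  define W where "W = {x. (1/2) *\<^sub>R (x + x0) \<in> P} \<inter> {x. (1/2) *\<^sub>R (x + x1) \<in> P}"
  have "open ((\<lambda>x. (1/2) *\<^sub>R (x + c)) -` P)" for c
    by (rule open_vimage[OF open_P]) (auto intro!: continuous_intros)
  then have "open W" by (auto simp: W_def vimage_def)
  have "W \<subseteq> closure P"
  proof
    fix y assume "y \<in> W"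
    show "y \<in> closure P"
      unfolding closure_iff_nhds_not_empty
    proof (intro allI impI)
      fix A V assume V: "V \<subseteq> A" "open V" "y \<in> V"
      obtain t where t: "t \<in> W \<inter> V" "H t \<le> d * fP t"
        using AE_lborel_open_obtain[OF AE, of "W \<inter> V"] \<open>open W\<close> \<open>y \<in> W\<close> V by blast
      then have "0 < H t" using f_pos by (auto simp: W_def H_def fP_simps)
      then have "t \<in> P" using t(2) fP_simps(2)[of t] by (cases "t \<in> P") auto
      then show "P \<inter> A \<noteq> {}" using t V by blast
    qed
  qed
  then have "W \<subseteq> P" using \<open>open W\<close> interior_closure_P interior_maximal by metis
  show ?thesis
  proof (rule that)
    show "touching x0 a0 x1 a1"
      unfolding touching_def homothetic_def
      using x a sq \<open>W \<subseteq> P\<close> f_pos by (auto simp: W_def less_imp_le mult.commute)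
    have "(sqrt (f p * f (p - 2 *\<^sub>R z)))\<^sup>2 \<le> d\<^sup>2" using pd nonneg by (intro power_mono) auto
    then show "f p * f (p - 2 *\<^sub>R z) \<le> a0 * a1" using nonneg a by simp
    show "a0 \<le> M" "a1 \<le> M" using aM M by blast+
  qed (rule x)
qed

lemma homothetic_limit:
  assumes hom: "\<And>k. homothetic (X k) (A k)" and X: "X \<longlonglongrightarrow> c" and A: "A \<longlonglongrightarrow> a" and a: "0 < a"
  shows "homothetic c a"
proof -
  have c: "c \<in> closure P"
    using hom by (intro closed_sequentially[OF closed_closure _ X]) (simp add: homothetic_def)
  moreover have "(f ((1/2) *\<^sub>R (x + c)))\<^sup>2 = a * f x" if x: "x \<in> P" for x
  proof (rule LIMSEQ_unique)
    show "(\<lambda>k. (f ((1/2) *\<^sub>R (x + X k)))\<^sup>2) \<longlonglongrightarrow> (f ((1/2) *\<^sub>R (x + c)))\<^sup>2"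
      by (intro tendsto_power tendsto_f_midpoint x c X)
    have "(f ((1/2) *\<^sub>R (x + X k)))\<^sup>2 = A k * f x" for k
      using hom x by (simp add: homothetic_def)
    then show "(\<lambda>k. (f ((1/2) *\<^sub>R (x + X k)))\<^sup>2) \<longlonglongrightarrow> a * f x"
      by (simp add: tendsto_mult_right A)
  qed
  ultimately show ?thesis using a by (simp add: homothetic_def)
qed

text \<open>Equality is known only for almost every \<open>z\<close>, so the pair is a limit of
  pairs for suitable \<open>z\<close> approaching half of \<open>p - p'\<close>. Uniform bounds on
  points and constants supply compactness, and a positive lower bound on the constants keeps the
  limit nondegenerate.\<close>

lemma touching_exists:
  assumes eq: "AE z in lborel. correlation_bound z \<le> difference_function f z" and p: "p \<in> P" "p' \<in> P"
  obtains x0 a0 x1 a1 where "x0 - x1 = p - p'" "touching x0 a0 x1 a1"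
proof -
  obtain M where M: "0 < M" "\<And>x. f x \<le> M" by (rule f_bounded) (rule that)
  define w where "w = p - p'"
  \<comment> \<open>A common lower bound for the products
    \<open>f p * f (p - 2 *\<^sub>R z)\<close>, valid once \<open>p - 2 *\<^sub>R z\<close> is so
    near \<open>p'\<close> that \<open>f\<close> exceeds \<open>f p' / 2\<close> there.\<close>
  define c where "c = f p * (f p' / 2)"
  have c: "0 < c" using f_pos p by (simp add: c_def)
  define V where "V = P \<inter> f -` {f p' / 2 <..}"
  have V: "open V" unfolding V_def using continuous_on_f open_P by (rule continuous_open_preimage) auto
  have ex: "\<exists>x0 a0 x1 a1. touching x0 a0 x1 a1 \<and> dist (x0 - x1) w < inverse (real (Suc k)) \<and>
      c \<le> a0 * a1 \<and> a0 \<le> M \<and> a1 \<le> M" for k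
  proof -
    define U where "U = (\<lambda>z. 2 *\<^sub>R z) -` ball w (inverse (real (Suc k))) \<inter> (\<lambda>z. p - 2 *\<^sub>R z) -` V"
    have "open U" unfolding U_def
      by (intro open_Int open_vimage V open_ball continuous_intros)
    moreover have "(1/2) *\<^sub>R w \<in> U"
      using p f_pos[OF p(2)] by (simp add: U_def V_def w_def)
    ultimately obtain z where z: "z \<in> U" "correlation_bound z \<le> difference_function f z"
      using AE_lborel_open_obtain[OF eq, of U] by blast
    then have zV: "p - 2 *\<^sub>R z \<in> P" "f p' / 2 < f (p - 2 *\<^sub>R z)" "dist (2 *\<^sub>R z) w < inverse (real (Suc k))"
      by (auto simp: U_def V_def dist_commute)
    obtain x0 a0 x1 a1 where x: "x0 - x1 = 2 *\<^sub>R z" "touching x0 a0 x1 a1"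
      and ge: "f p * f (p - 2 *\<^sub>R z) \<le> a0 * a1" and le: "a0 \<le> M" "a1 \<le> M"
      by (rule touching_of_equality[OF z(2) p(1) zV(1) M(2)]) (rule that)
    have "c \<le> f p * f (p - 2 *\<^sub>R z)"
      unfolding c_def using zV nonneg by (intro mult_left_mono) auto
    then have "touching x0 a0 x1 a1 \<and> dist (x0 - x1) w < inverse (real (Suc k)) \<and> c \<le> a0 * a1 \<and> a0 \<le> M \<and> a1 \<le> M"
      using x ge le zV(3) by auto
    then show ?thesis by blast
  qed
  then obtain X0 A0 X1 A1 where
    t: "\<And>k. touching (X0 k) (A0 k) (X1 k) (A1 k)" and
    dist_w: "\<And>k. dist (X0 k - X1 k) w < inverse (real (Suc k))" and
    A: "\<And>k. c \<le> A0 k * A1 k" "\<And>k. A0 k \<le> M" "\<And>k. A1 k \<le> M"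
    by metis
  have hom: "homothetic (X0 k) (A0 k)" "homothetic (X1 k) (A1 k)" for k
    using t by (simp_all add: touching_def)
  then have pos: "0 < A0 k" "0 < A1 k" for k by (auto simp: homothetic_def)
  have A_ge: "c / M \<le> A0 k" "c / M \<le> A1 k" for k
  proof -
    have "A0 k * A1 k \<le> A0 k * M" "A0 k * A1 k \<le> M * A1 k"
      using A pos[of k] M by (auto intro!: mult_left_mono mult_right_mono)
    then show "c / M \<le> A0 k" "c / M \<le> A1 k"
      using A(1)[of k] M(1) by (auto simp: field_simps)
  qed
  \<comment> \<open>Homothety with constant at least \<open>c / M\<close> makes \<open>f\<close> at
    least \<open>e\<close> at the midpoint of \<open>p\<close> and the contact point, which confines
    that point to a bounded set.\<close>
  define e where "e = sqrt (c / M * f p)"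
  have e: "0 < e" using c M f_pos[OF p(1)] by (simp add: e_def)
  obtain R where R: "\<And>y. e \<le> f y \<Longrightarrow> norm y \<le> R"
    using bounded_superlevel[OF e] by (auto simp: bounded_iff)
  have bound: "norm x \<le> 2 * R + norm p" if "homothetic x a" "c / M \<le> a" for x a
  proof -
    have "(f ((1/2) *\<^sub>R (p + x)))\<^sup>2 = a * f p" using that p by (simp add: homothetic_def)
    moreover have "c / M * f p \<le> a * f p" using that nonneg by (intro mult_right_mono) auto
    ultimately have "e \<le> f ((1/2) *\<^sub>R (p + x))"
      unfolding e_def using nonneg by (intro real_le_lsqrt) auto
    from R[OF this] have "norm (p + x) \<le> 2 * R" by simp
    then show ?thesis using norm_triangle_ineq4[of "p + x" p] by simp
  qed
  define s where "s k = (X0 k, X1 k, A0 k, A1 k)" for k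
  have "bounded (cball (0::'a) (2 * R + norm p) \<times> cball (0::'a) (2 * R + norm p) \<times> {c / M..M} \<times> {c / M..M})"
    by (intro bounded_Times) auto
  moreover have "range s \<subseteq> cball (0::'a) (2 * R + norm p) \<times> cball (0::'a) (2 * R + norm p) \<times> {c / M..M} \<times> {c / M..M}"
    using A A_ge bound[OF hom(1) A_ge(1)] bound[OF hom(2) A_ge(2)] by (auto simp: s_def)
  ultimately have "bounded (range s)" by (rule bounded_subset)
  then obtain l r where r: "strict_mono r" and "(s \<circ> r) \<longlonglongrightarrow> l"
    using bounded_imp_convergent_subsequence by blast
  moreover obtain x0 x1 a0 a1 where l: "l = (x0, x1, a0, a1)" by (cases l)
  ultimately have lim: "(\<lambda>k. (X0 (r k), X1 (r k), A0 (r k), A1 (r k))) \<longlonglongrightarrow> (x0, x1, a0, a1)"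
    by (simp add: s_def o_def)
  note lims = tendsto_fst[OF lim] tendsto_fst[OF tendsto_snd[OF lim]]
    tendsto_fst[OF tendsto_snd[OF tendsto_snd[OF lim]]] tendsto_snd[OF tendsto_snd[OF tendsto_snd[OF lim]]]
  have x0: "(\<lambda>k. X0 (r k)) \<longlonglongrightarrow> x0" and x1: "(\<lambda>k. X1 (r k)) \<longlonglongrightarrow> x1"
    and a0: "(\<lambda>k. A0 (r k)) \<longlonglongrightarrow> a0" and a1: "(\<lambda>k. A1 (r k)) \<longlonglongrightarrow> a1"
    using lims by simp_all
  have "c / M \<le> a0" "c / M \<le> a1"
    using A_ge by (auto intro: LIMSEQ_le_const[OF a0] LIMSEQ_le_const[OF a1])
  moreover have "0 < c / M" using c M by simp
  ultimately have a: "0 < a0" "0 < a1" by linarith+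
  have "homothetic x0 a0" "homothetic x1 a1"
    using hom by (auto intro: homothetic_limit[OF _ x0 a0 a(1)] homothetic_limit[OF _ x1 a1 a(2)])
  \<comment> \<open>Since \<open>P\<close> is open, both midpoint conditions already hold for the
    approximating pairs at large indices.\<close>
  moreover have "x \<in> P" if x: "(1/2) *\<^sub>R (x + x0) \<in> P" "(1/2) *\<^sub>R (x + x1) \<in> P" for x
  proof -
    have "\<forall>\<^sub>F k in sequentially. (1/2) *\<^sub>R (x + X0 (r k)) \<in> P"
      by (rule topological_tendstoD[OF _ open_P x(1)]) (intro tendsto_intros x0)
    moreover have "\<forall>\<^sub>F k in sequentially. (1/2) *\<^sub>R (x + X1 (r k)) \<in> P"
      by (rule topological_tendstoD[OF _ open_P x(2)]) (intro tendsto_intros x1)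
    ultimately have "\<forall>\<^sub>F k in sequentially. x \<in> P"
      by eventually_elim (use t in \<open>auto simp: touching_def\<close>)
    then show ?thesis by simp
  qed
  ultimately have "touching x0 a0 x1 a1" by (simp add: touching_def)
  moreover have "x0 - x1 = w"
  proof (rule LIMSEQ_unique)
    show "(\<lambda>k. X0 (r k) - X1 (r k)) \<longlonglongrightarrow> x0 - x1" by (intro tendsto_intros x0 x1)
    have "(\<lambda>k. X0 k - X1 k) \<longlonglongrightarrow> w"
      by (rule metric_tendsto_imp_tendsto[OF LIMSEQ_inverse_real_of_nat])
         (use dist_w in \<open>auto intro!: always_eventually less_imp_le\<close>)
    then show "(\<lambda>k. X0 (r k) - X1 (r k)) \<longlonglongrightarrow> w"
      using LIMSEQ_subseq_LIMSEQ[OF _ r] by (fastforce simp: o_def)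
  qed
  ultimately show ?thesis using that by (simp add: w_def)
qed

lemma AE_equality:
  assumes "(\<integral>\<^sup>+z. difference_function f z \<partial>lebesgue) = 2 ^ DIM('a) * (\<integral>\<^sup>+x. ennreal (f x) \<partial>lebesgue)"
  shows "AE z in lborel. correlation_bound z \<le> difference_function f z"
proof (rule AE_eq_of_nn_integral_le)
  have *: "(\<integral>\<^sup>+z. difference_function f z \<partial>lborel) = 2 ^ DIM('a) * mass"
    using assms unfolding nn_integral_f by (simp add: nn_integral_completion)
  show "(\<integral>\<^sup>+z. correlation_bound z \<partial>lborel) \<le> (\<integral>\<^sup>+z. difference_function f z \<partial>lborel)"
    by (simp add: * nn_integral_correlation_bound)
  show "(\<integral>\<^sup>+z. difference_function f z \<partial>lborel) \<noteq> \<infinity>"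
    unfolding * using mass_finite by (simp add: ennreal_mult_eq_top_iff power_eq_top_ennreal)
qed (simp_all add: difference_function_le)

text \<open>For the difference \<open>p - p = 0\<close> the two contact points coincide. Their
  common value \<open>v\<close> is the apex: the contact inclusion says that dilation by 2 about
  \<open>v\<close> maps \<open>P\<close> into itself.\<close>

lemma touching_cone_translate:
  assumes eq: "AE z in lborel. correlation_bound z \<le> difference_function f z"
  obtains v a where "touching_cone ((+) (- v) ` P) (\<lambda>x. f (v + x)) a"
proof -
  obtain p where "p \<in> P" using P_nonempty by blast
  then obtain v a v' a' where v: "v - v' = p - p" "touching v a v' a'"
    using touching_exists[OF eq] by metis
  then have hom: "homothetic v a" and cone: "\<And>x. (1/2) *\<^sub>R (x + v) \<in> P \<Longrightarrow> x \<in> P"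
    by (auto simp: touching_def)
  define Q where "Q = (+) (- v) ` P"
  have half: "(1/2) *\<^sub>R v + (1/2) *\<^sub>R v = v"
    using scaleR_half_double[of v] by (simp only: scaleR_add_right)
  have Q: "x \<in> Q \<longleftrightarrow> v + x \<in> P" for x
    by (force simp: Q_def image_iff algebra_simps)
  have cQ: "x \<in> closure Q \<longleftrightarrow> v + x \<in> closure P" for x
    unfolding Q_def closure_translation by (force simp: image_iff algebra_simps)
  have "touching_cone Q (\<lambda>x. f (v + x)) a"
  proof (rule touching_cone.intro)
    show "open Q" "convex Q" "Q \<noteq> {}"
      unfolding Q_def using open_translation[OF open_P] convex_translation[OF convex_P] P_nonempty by blast+
    show "0 \<in> closure Q" using hom by (simp add: cQ homothetic_def)
    show "2 *\<^sub>R x \<in> Q" if "x \<in> Q" for x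
    proof -
      have "(1/2) *\<^sub>R ((v + 2 *\<^sub>R x) + v) = v + x" using half by (simp add: algebra_simps)
      then show ?thesis using that cone[of "v + 2 *\<^sub>R x"] by (simp add: Q)
    qed
    show "0 < a" using hom by (simp add: homothetic_def)
    show "0 < f (v + x)" if "x \<in> Q" for x using that f_pos by (simp add: Q)
    show "(f (v + (1/2) *\<^sub>R x))\<^sup>2 = a * f (v + x)" if "x \<in> Q" for x
    proof -
      have "(1/2) *\<^sub>R ((v + x) + v) = v + (1/2) *\<^sub>R x" using half by (simp add: algebra_simps)
      then show ?thesis using hom that by (metis Q homothetic_def)
    qed
    show "f (v + x) powr (1 - t) * f (v + y) powr t \<le> f (v + ((1 - t) *\<^sub>R x + t *\<^sub>R y))"
      if "0 < t" "t < 1" for x y t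
      using f_convex_comb[of t "v + x" "v + y"] that by (simp add: algebra_simps)
    show "bounded {x \<in> Q. e \<le> f (v + x)}" if "0 < e" for e
    proof -
      have "{x \<in> Q. e \<le> f (v + x)} \<subseteq> (+) (- v) ` {x. e \<le> f x}"
        by (force simp: image_iff algebra_simps)
      then show ?thesis using bounded_superlevel[OF that] bounded_translation bounded_subset by blast
    qed
    fix q q' assume "q \<in> Q" "q' \<in> Q"
    then have "v + q \<in> P" "v + q' \<in> P" by (simp_all add: Q)
    then obtain x0 a0 x1 a1 where x: "x0 - x1 = (v + q) - (v + q')" "touching x0 a0 x1 a1"
      by (rule touching_exists[OF eq])
    define y0 y1 where "y0 = x0 - v" and "y1 = x1 - v"
    have mid: "(1/2) *\<^sub>R ((v + z) + x0) = v + (1/2) *\<^sub>R (z + y0)"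
      "(1/2) *\<^sub>R ((v + z) + x1) = v + (1/2) *\<^sub>R (z + y1)" for z
      using half by (simp_all add: y0_def y1_def algebra_simps)
    have "y0 - y1 = q - q'" using x(1) by (simp add: y0_def y1_def)
    moreover have "y0 \<in> closure Q" "0 < a0" "y1 \<in> closure Q" "0 < a1"
      using x(2) by (simp_all add: touching_def homothetic_def cQ y0_def y1_def)
    moreover have "\<forall>z\<in>Q. (f (v + (1/2) *\<^sub>R (z + y0)))\<^sup>2 = a0 * f (v + z)"
      "\<forall>z\<in>Q. (f (v + (1/2) *\<^sub>R (z + y1)))\<^sup>2 = a1 * f (v + z)"
      using x(2) unfolding mid[symmetric] touching_def homothetic_def by (auto simp: Q)
    moreover have "\<forall>z. (1/2) *\<^sub>R (z + y0) \<in> Q \<longrightarrow> (1/2) *\<^sub>R (z + y1) \<in> Q \<longrightarrow> z \<in> Q"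
      using x(2) unfolding Q mid[symmetric] touching_def by blast
    ultimately show "\<exists>x0 a0 x1 a1. x0 - x1 = q - q' \<and>
      x0 \<in> closure Q \<and> 0 < a0 \<and> (\<forall>x\<in>Q. (f (v + (1/2) *\<^sub>R (x + x0)))\<^sup>2 = a0 * f (v + x)) \<and>
      x1 \<in> closure Q \<and> 0 < a1 \<and> (\<forall>x\<in>Q. (f (v + (1/2) *\<^sub>R (x + x1)))\<^sup>2 = a1 * f (v + x)) \<and>
      (\<forall>x. (1/2) *\<^sub>R (x + x0) \<in> Q \<longrightarrow> (1/2) *\<^sub>R (x + x1) \<in> Q \<longrightarrow> x \<in> Q)"
      by blast
  qed
  then show ?thesis using that unfolding Q_def by blast
qed

end

subsection \<open>The equality case\<close>

lemma interior_nonneg_orthant: "interior {x :: real ^ 'n. \<forall>i. 0 \<le> x $ i} = {x. \<forall>i. 0 < x $ i}"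
proof
  show "interior {x :: real ^ 'n. \<forall>i. 0 \<le> x $ i} \<subseteq> {x. \<forall>i. 0 < x $ i}"
  proof (intro subsetI CollectI allI)
    fix x :: "real ^ 'n" and i
    assume "x \<in> interior {x. \<forall>i. 0 \<le> x $ i}"
    moreover have "interior {x. \<forall>i. 0 \<le> x $ i} \<subseteq> interior {x :: real ^ 'n. 0 \<le> x $ i}"
      by (rule interior_mono) auto
    ultimately have "x \<in> interior {x. 0 \<le> x $ i}" by blast
    then show "0 < x $ i" using interior_halfspace_component_ge[of 0 i] by simp
  qed
  have "open {x :: real ^ 'n. 0 < x $ i}" for i
    by (intro open_Collect_less continuous_intros)
  then have "open (\<Inter>i. {x :: real ^ 'n. 0 < x $ i})" by (intro open_INT) auto
  moreover have "(\<Inter>i. {x :: real ^ 'n. 0 < x $ i}) = {x. \<forall>i. 0 < x $ i}" by auto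
  ultimately have "open {x :: real ^ 'n. \<forall>i. 0 < x $ i}" by simp
  then show "{x :: real ^ 'n. \<forall>i. 0 < x $ i} \<subseteq> interior {x. \<forall>i. 0 \<le> x $ i}"
    by (intro interior_maximal) (auto simp: less_imp_le)
qed

text \<open>The columns of \<open>A\<close> are the extreme points of the base. They form a basis on
  which \<open>L\<close> equals 1, so the cone is the image of the nonnegative orthant and
  \<open>L\<close> becomes the coordinate sum.\<close>

lemma lattice_cone_coordinates:
  fixes K :: "(real ^ 'n) set"
  assumes "lattice_cone K L"
  obtains A :: "real ^ 'n ^ 'n" where "invertible A" "\<And>x. L (A *v x) = (\<Sum>i\<in>UNIV. x $ i)"
    "interior K = (*v) A ` {x. \<forall>i. 0 < x $ i}"
proof -
  interpret lattice_cone K L by fact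
  have "card (UNIV :: 'n set) = card extr" unfolding card_extr by simp
  then obtain e :: "'n \<Rightarrow> real ^ 'n" where e: "bij_betw e UNIV extr"
    using finite_same_card_bij[of "UNIV :: 'n set" extr] finite_extr by auto
  define A :: "real ^ 'n ^ 'n" where "A = (\<chi> i j. e j $ i)"
  have A: "A *v x = (\<Sum>j\<in>UNIV. x $ j *\<^sub>R e j)" for x
    by (simp add: A_def vec_eq_iff matrix_vector_mult_def mult.commute)
  have lin: "linear ((*v) A)" by (rule matrix_vector_mul_linear)
  have "e j = A *v axis j 1" for j
  proof -
    have "(\<Sum>i\<in>UNIV. axis j 1 $ i *\<^sub>R e i) = (\<Sum>i\<in>UNIV. if i = j then e i else 0)"
      by (rule sum.cong) (auto simp: axis_def)
    then show ?thesis by (simp add: A)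
  qed
  then have "e ` UNIV \<subseteq> range ((*v) A)" by (intro image_subsetI) simp
  then have "extr \<subseteq> range ((*v) A)" unfolding bij_betw_imp_surj_on[OF e] .
  moreover have "subspace (range ((*v) A))" using lin by (simp add: linear_subspace_image)
  ultimately have "span extr \<subseteq> range ((*v) A)" by (rule span_minimal)
  then have surj: "surj ((*v) A)" using span_extr by auto
  have inv: "invertible A"
    using surj by (simp add: invertible_right_inverse matrix_right_invertible_surjective)
  then have inj: "inj ((*v) A)" by (simp add: invertible_left_inverse matrix_left_invertible_injective)
  have "L (A *v x) = (\<Sum>i\<in>UNIV. x $ i)" for x
  proof -
    have "L (e j) = 1" for j
      using extr_base e by (auto simp: bij_betw_def base_def)
    then show ?thesis by (simp add: A linear_sum[OF L_linear] linear_scale[OF L_linear])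
  qed
  moreover have "K = (*v) A ` {x. \<forall>i. 0 \<le> x $ i}"
  proof (intro set_eqI iffI)
    fix y assume "y \<in> K"
    then obtain u where u: "\<forall>z\<in>extr. 0 \<le> u z" "y = (\<Sum>z\<in>extr. u z *\<^sub>R z)"
      using cone_eq_sums[of y] by auto
    then have "y = A *v (\<chi> i. u (e i))"
      by (simp add: A sum.reindex_bij_betw[OF e, of "\<lambda>z. u z *\<^sub>R z"])
    moreover have "(\<chi> i. u (e i)) \<in> {x. \<forall>i. 0 \<le> x $ i}"
      using u(1) e by (auto simp: bij_betw_def)
    ultimately show "y \<in> (*v) A ` {x. \<forall>i. 0 \<le> x $ i}" by blast
  next
    fix y assume "y \<in> (*v) A ` {x. \<forall>i. 0 \<le> x $ i}"
    then obtain x where x: "\<forall>i. 0 \<le> x $ i" "y = A *v x" by auto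
    define u where "u z = x $ inv_into UNIV e z" for z
    have "u (e i) = x $ i" for i
      using e by (simp add: u_def bij_betw_def)
    then have "y = (\<Sum>z\<in>extr. u z *\<^sub>R z)"
      by (simp add: x A sum.reindex_bij_betw[OF e, of "\<lambda>z. u z *\<^sub>R z", symmetric])
    moreover have "\<forall>z\<in>extr. 0 \<le> u z" using x by (simp add: u_def)
    ultimately show "y \<in> K" using cone_eq_sums[of y] by auto
  qed
  then have "interior K = (*v) A ` {x. \<forall>i. 0 < x $ i}"
    by (simp add: interior_injective_linear_image[OF lin inj] interior_nonneg_orthant)
  ultimately show ?thesis using that inv by blast
qed

theorem theorem1p3:
  fixes f :: "real ^ 'n \<Rightarrow> real"
  assumes "\<And>x. f x \<ge> 0"
    and "log_concave f"
    and "integrable lebesgue f"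
    and "interior (positivity_set f) \<noteq> {}"
    and "(\<integral>\<^sup>+ z. difference_function f z \<partial>lebesgue) = 2 ^ CARD('n) * (\<integral>\<^sup>+ x. ennreal (f x) \<partial>lebesgue)"
  shows "\<exists>(A :: real ^ 'n ^ 'n) (C :: real) (x0 :: real ^ 'n).
           invertible A \<and> C > 0 \<and>
           (let h = (\<lambda>x. C * f (A *v x + x0)) in
              interior (positivity_set h) = {x. \<forall>i. x $ i > 0} \<and>
              (\<forall>z \<in> interior (positivity_set h). h z = exp (- (\<Sum>i\<in>UNIV. z $ i))))"
proof -
  interpret lc: integrable_log_concave f
    using assms by (intro integrable_log_concave.intro)
  have "AE z in lborel. lc.correlation_bound z \<le> difference_function f z"
    using assms(5) by (intro lc.AE_equality) simp
  then obtain v a where "touching_cone ((+) (- v) ` lc.P) (\<lambda>x. f (v + x)) a"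
    by (rule lc.touching_cone_translate)
  then interpret tc: touching_cone "(+) (- v) ` lc.P" "\<lambda>x. f (v + x)" a .
  obtain A :: "real ^ 'n ^ 'n" where A: "invertible A" "\<And>x. tc.L (A *v x) = (\<Sum>i\<in>UNIV. x $ i)"
    "interior (closure ((+) (- v) ` lc.P)) = (*v) A ` {x. \<forall>i. 0 < x $ i}"
    using tc.lattice_cone_axioms by (rule lattice_cone_coordinates) (rule that)
  have Q: "(+) (- v) ` lc.P = (*v) A ` {x. \<forall>i. 0 < x $ i}"
    using A(3) tc.Q_eq_interior by simp
  have lin: "linear ((*v) A)" by (rule matrix_vector_mul_linear)
  have inj: "inj ((*v) A)"
    using A(1) by (simp add: invertible_left_inverse matrix_left_invertible_injective)
  \<comment> \<open>The factor \<open>1 / a\<close> cancels the constant in \<open>g_eq_exp\<close>,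
    and the shift \<open>v\<close> moves the apex to the origin.\<close>
  define h where "h x = (1 / a) * f (A *v x + v)" for x
  \<comment> \<open>The identity is between the full positivity sets; interiors then follow, since
    they commute with translations and with the injective linear map of \<open>A\<close>.\<close>
  have "(+) (- v) ` positivity_set f = (*v) A ` positivity_set h"
  proof (intro set_eqI iffI)
    fix y assume "y \<in> (+) (- v) ` positivity_set f"
    then have y: "0 < f (v + y)" by (auto simp: positivity_set_def)
    obtain B where "A ** B = mat 1" using A(1) by (auto simp: invertible_def)
    then have Ay: "y = A *v (B *v y)" by (simp add: matrix_vector_mul_assoc)
    then have "0 < h (B *v y)" using y tc.a_pos by (simp add: h_def add.commute)
    then show "y \<in> (*v) A ` positivity_set h"
      unfolding positivity_set_def using Ay by blast
  next
    fix y assume "y \<in> (*v) A ` positivity_set h"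
    then have "v + y \<in> positivity_set f"
      using tc.a_pos by (auto simp: h_def positivity_set_def zero_less_divide_iff add.commute)
    then show "y \<in> (+) (- v) ` positivity_set f" by (intro image_eqI[of _ _ "v + y"]) auto
  qed
  then have "interior ((*v) A ` positivity_set h) = (+) (- v) ` lc.P"
    unfolding lc.P_def by (metis interior_translation)
  then have "(*v) A ` interior (positivity_set h) = (+) (- v) ` lc.P"
    by (simp only: interior_injective_linear_image[OF lin inj])
  then have int: "interior (positivity_set h) = {x. \<forall>i. 0 < x $ i}"
    unfolding Q using inj by (simp add: inj_image_eq_iff)
  have "h z = exp (- (\<Sum>i\<in>UNIV. z $ i))" if "\<forall>i. 0 < z $ i" for z
  proof -
    have "A *v z \<in> (+) (- v) ` lc.P" unfolding Q using that by blast
    from tc.g_eq_exp[OF this] have "f (v + A *v z) = a * exp (- (\<Sum>i\<in>UNIV. z $ i))"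
      unfolding A(2) .
    then show ?thesis using tc.a_pos by (simp add: h_def add.commute)
  qed
  then have "invertible A \<and> 1 / a > 0 \<and>
           (let h = (\<lambda>x. (1 / a) * f (A *v x + v)) in
              interior (positivity_set h) = {x. \<forall>i. x $ i > 0} \<and>
              (\<forall>z \<in> interior (positivity_set h). h z = exp (- (\<Sum>i\<in>UNIV. z $ i))))"
    using A(1) tc.a_pos int unfolding Let_def h_def by auto
  then show ?thesis by blast
qed

end
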